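(* Let $\mathcal{P}_4=\{S^1,\mathbb{R}\}$. Then $\mathcal{N}^{cell}(\mathcal{P}_4)$ is the class of polycyclic groups.
   Context: Cellular actions: a group $G$ acts cellularly on a CW-complex $X$ if it acts by homeomorphisms permuting the open cells, and the stabilizer of any cell fixes that cell pointwise. The class $\mathcal{N}^{cell}(\mathcal{P})$: for a class $\mathcal{P}$ of finite dimensional CW-complexes, $\mathcal{N}^{cell}(\mathcal{P})$ is the smallest class of groups containing the trivial group with the property that if a group $G$ acts cellularly on some $X\in\mathcal{P}$ such that all isotropy groups are in $\mathcal{N}^{cell}(\mathcal{P})$, then $G$ is in $\mathcal{N}^{cell}(\mathcal{P})$. The spaces listed in $\mathcal{P}_4$ (the circle and the real line) are allowed to carry any CW-structure. *)

theory Defs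
  imports "HOL-Analysis.Analysis" "HOL-Algebra.Group_Action" "HOL-Algebra.Elementary_Groups"
begin

definition closed_disc :: "nat \<Rightarrow> (nat \<Rightarrow> real) set"
  where "closed_disc n = {x \<in> topspace (Euclidean_space n). (\<Sum>i<n. x i ^ 2) \<le> 1}"

definition open_disc :: "nat \<Rightarrow> (nat \<Rightarrow> real) set"
  where "open_disc n = {x \<in> topspace (Euclidean_space n). (\<Sum>i<n. x i ^ 2) < 1}"

text \<open>A space together with its open cells, sorted by dimension: \<open>cells X n\<close> is the set of
  open \<open>n\<close>-cells, as subsets of the space. Characteristic maps are not part of the data; they are
  only required to exist.\<close>

record 'x cell_structure =
  space :: "'x topology"
  cells :: "nat \<Rightarrow> 'x set set"

definition open_cells :: "'x cell_structure \<Rightarrow> 'x set set"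
  where "open_cells X = (\<Union>n. cells X n)"

text \<open>The last conjunct is closure-finiteness: the boundary of the disc goes into finitely many
  cells of lower dimension. For \<open>n = 0\<close> both discs are the one-point space, so a \<open>0\<close>-cell is a
  singleton.\<close>

definition characteristic_map ::
    "'x cell_structure \<Rightarrow> nat \<Rightarrow> 'x set \<Rightarrow> ((nat \<Rightarrow> real) \<Rightarrow> 'x) \<Rightarrow> bool"
  where "characteristic_map X n e \<Phi> \<longleftrightarrow>
    continuous_map (subtopology (Euclidean_space n) (closed_disc n)) (space X) \<Phi> \<and>
    homeomorphic_map (subtopology (Euclidean_space n) (open_disc n)) (subtopology (space X) e) \<Phi> \<and>
    (\<exists>F. finite F \<and> F \<subseteq> (\<Union>m<n. cells X m) \<and> \<Phi> ` (closed_disc n - open_disc n) \<subseteq> \<Union>F)"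

text \<open>Whitehead's definition of a CW-complex.\<close>

definition CW_complex :: "'x cell_structure \<Rightarrow> bool"
  where "CW_complex X \<longleftrightarrow>
    Hausdorff_space (space X) \<and>
    \<Union>(open_cells X) = topspace (space X) \<and>
    (\<forall>m n. \<forall>d\<in>cells X m. \<forall>e\<in>cells X n. d \<inter> e \<noteq> {} \<longrightarrow> m = n \<and> d = e) \<and>
    (\<forall>n. \<forall>e\<in>cells X n. e \<subseteq> topspace (space X) \<and> (\<exists>\<Phi>. characteristic_map X n e \<Phi>)) \<and>
    (\<forall>A\<subseteq>topspace (space X).
       closedin (space X) A \<longleftrightarrow>
       (\<forall>e\<in>open_cells X. closedin (space X) (A \<inter> (space X closure_of e))))"

definition cellular_action ::
    "('a, 'b) monoid_scheme \<Rightarrow> 'x cell_structure \<Rightarrow> ('a \<Rightarrow> 'x \<Rightarrow> 'x) \<Rightarrow> bool"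
  where "cellular_action G X \<phi> \<longleftrightarrow>
    group_action G (topspace (space X)) \<phi> \<and>
    (\<forall>g\<in>carrier G. homeomorphic_map (space X) (space X) (\<phi> g)) \<and>
    (\<forall>g\<in>carrier G. bij_betw (\<lambda>e. \<phi> g ` e) (open_cells X) (open_cells X)) \<and>
    (\<forall>g\<in>carrier G. \<forall>e\<in>open_cells X. \<phi> g ` e = e \<longrightarrow> (\<forall>x\<in>e. \<phi> g x = x))"

text \<open>The least class of groups that contains the trivial groups and is closed under forming
  groups which act cellularly on a member of \<open>P\<close> with all isotropy groups in the class. Isotropy
  groups are subgroups, so the closure condition never leaves the carrier type of \<open>G\<close>, and this
  predicate is the part of the class consisting of the groups over that type.\<close>

inductive Ncell :: "'x cell_structure set \<Rightarrow> ('a, 'b) monoid_scheme \<Rightarrow> bool"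
  for P :: "'x cell_structure set"
  where
    trivial: "trivial_group G \<Longrightarrow> Ncell P G"
  | action: "\<lbrakk> group G; X \<in> P; cellular_action G X \<phi>;
               \<And>x. x \<in> topspace (space X) \<Longrightarrow> Ncell P (G \<lparr> carrier := stabilizer G \<phi> x \<rparr>) \<rbrakk>
             \<Longrightarrow> Ncell P G"

text \<open>All CW-structures on a circle or a line. Both spaces embed in the plane, so the complex
  numbers serve as a common point type.\<close>

definition P4 :: "complex cell_structure set"
  where "P4 = {X. CW_complex X \<and>
    (space X homeomorphic_space top_of_set (sphere (0::complex) 1) \<or>
     space X homeomorphic_space (euclidean :: real topology))}"

text \<open>A group is polycyclic if it has a finite subnormal series from the trivial subgroup to the
  whole group with cyclic factors.\<close>

inductive polycyclic_seq :: "('a, 'b) monoid_scheme \<Rightarrow> 'a set \<Rightarrow> bool"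
  for G where
    unity: "polycyclic_seq G {\<one>\<^bsub>G\<^esub>}"
  | extension: "\<lbrakk> polycyclic_seq G K; subgroup H G; K \<lhd> (G \<lparr> carrier := H \<rparr>);
                  cyclic_group ((G \<lparr> carrier := H \<rparr>) Mod K) \<rbrakk> \<Longrightarrow> polycyclic_seq G H"

definition polycyclic_group :: "('a, 'b) monoid_scheme \<Rightarrow> bool"
  where "polycyclic_group G \<longleftrightarrow> group G \<and> polycyclic_seq G (carrier G)"

end

theory Submission
  imports Defs
begin

text \<open>
  Both inclusions rest on one description of the two spaces: each is the quotient of the real line by
  translation by multiples of a natural number \<open>n\<close>, with \<open>n = 0\<close> for the line.

  A polycyclic group belongs to the class by induction along its series. If \<open>H\<close> modulo \<open>K\<close> is cyclic
  of order \<open>n\<close>, where \<open>n = 0\<close> stands for infinite order, then \<open>H\<close> acts through this quotient by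
  integer translations on the line modulo \<open>n\<close>, with the integers as vertices. The action of the
  quotient is free, so every isotropy group is \<open>K\<close> (\<open>cyclic_FactGroup_acts\<close>).

  Conversely, let \<open>G\<close> act on a CW-complex \<open>X\<close> homeomorphic to a line or a circle. The vertices of \<open>X\<close>
  form a nonempty, closed, discrete and \<open>G\<close>-invariant set, so their preimage \<open>D\<close> in the line is locally
  finite. Every element of \<open>G\<close> lifts to a monotone bijection of the line preserving \<open>D\<close>. The elements
  with an increasing lift form a normal subgroup of index at most two. An increasing lift
  that fixes one point \<open>v\<close> of \<open>D\<close> fixes all of \<open>D\<close>, by counting points between \<open>v\<close> and another point
  of \<open>D\<close> and its image. Hence the elements with an increasing lift fixing \<open>v\<close> form a normal subgroup of
  the orientation-preserving ones, and the quotient is cyclic, generated by an element that moves \<open>v\<close>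
  to the next point of its orbit (\<open>orientation_preserving_cyclic_over_fixer\<close>). That normal subgroup lies
  in the isotropy group of the vertex below \<open>v\<close>, so it is polycyclic if the isotropy groups are, and then
  so is \<open>G\<close> (\<open>polycyclic_if_fixer_polycyclic\<close>).
\<close>

section \<open>Polycyclic series\<close>

lemma int_subgroup_multiples:
  fixes I :: "int set"
  assumes "0 \<in> I" and diff: "\<And>m n. \<lbrakk>m \<in> I; n \<in> I\<rbrakk> \<Longrightarrow> m - n \<in> I"
  obtains d where "d \<ge> 0" "I = {n. d dvd n}"
proof (cases "I = {0}")
  case True
  then show ?thesis using that[of 0] by auto
next
  case False
  have neg: "- n \<in> I" if "n \<in> I" for n using diff[OF \<open>0 \<in> I\<close> that] by simp
  have add: "m + n \<in> I" if "m \<in> I" "n \<in> I" for m n using diff[OF that(1) neg[OF that(2)]] by simp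
  have mult_nat: "int k * n \<in> I" if "n \<in> I" for k n
    by (induction k) (use that add assms(1) in \<open>auto simp: algebra_simps\<close>)
  have mult: "k * n \<in> I" if "n \<in> I" for k n
    using mult_nat[OF that] neg[OF mult_nat[OF that]]
    by (cases k) (simp_all del: of_nat_Suc)
  obtain m where m: "m \<in> I" "m \<noteq> 0" using False \<open>0 \<in> I\<close> by blast
  have "\<exists>k::nat. k > 0 \<and> int k \<in> I"
    using m neg[OF m(1)] by (intro exI[of _ "nat \<bar>m\<bar>"]) (auto simp: abs_if)
  define k where "k = (LEAST k::nat. k > 0 \<and> int k \<in> I)"
  have k: "k > 0" "int k \<in> I"
    using LeastI_ex[OF \<open>\<exists>k::nat. k > 0 \<and> int k \<in> I\<close>] by (simp_all add: k_def)
  have least: "k \<le> j" if "j > 0 \<and> int j \<in> I" for j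
    using that unfolding k_def by (intro Least_le)
  have "int k dvd n" if "n \<in> I" for n
  proof (rule ccontr)
    assume "\<not> int k dvd n"
    then have "n mod int k \<noteq> 0" by (simp add: dvd_eq_mod_eq_0)
    moreover have "n mod int k \<ge> 0" using k by simp
    ultimately have pos: "n mod int k > 0" by linarith
    have "n mod int k \<in> I"
      using diff[OF that mult[OF k(2), of "n div int k"]] by (simp add: minus_div_mult_eq_mod)
    then have "k \<le> nat (n mod int k)" using least pos by simp
    moreover have "n mod int k < int k" using k by simp
    ultimately show False using pos by linarith
  qed
  then have "I = {n. int k dvd n}" using mult[OF k(2)] by (auto simp: dvd_def mult.commute)
  then show ?thesis using that[of "int k"] by simp
qed

lemma (in normal) rcos_eq_iff:
  assumes "x \<in> carrier G" "y \<in> carrier G"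
  shows "x \<in> H #> y \<longleftrightarrow> H #> x = H #> y"
  using assms repr_independence[of x H y] rcos_self[of x H] subgroup_axioms by auto

text \<open>Cyclicity of the quotient is handled through exponents: every coset is \<open>H #> a [^] n\<close> for
  some integer \<open>n\<close>. This avoids computing inside a factor group whose carrier changes with each
  term of a series.\<close>

lemma (in normal) cyclic_FactGroup_iff:
  "cyclic_group (G Mod H) \<longleftrightarrow>
    (\<exists>a\<in>carrier G. \<forall>x\<in>carrier G. \<exists>n::int. H #> x = H #> a [^] n)"
proof -
  interpret Q: group "G Mod H" by (rule factorgroup_is_group)
  have "carrier (G Mod H) = range (\<lambda>n::int. (H #> a) [^]\<^bsub>G Mod H\<^esub> n) \<longleftrightarrow>
      (\<forall>x\<in>carrier G. \<exists>n::int. H #> x = H #> a [^] n)" (is "?L \<longleftrightarrow> ?R") if "a \<in> carrier G" for a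
  proof -
    have "?L \<longleftrightarrow> (\<lambda>x. H #> x) ` carrier G = range (\<lambda>n::int. H #> a [^] n)"
      using that by (simp add: FactGroup_int_pow carrier_FactGroup)
    also have "\<dots> \<longleftrightarrow> (\<lambda>x. H #> x) ` carrier G \<subseteq> range (\<lambda>n::int. H #> a [^] n)"
      using that by blast
    also have "\<dots> \<longleftrightarrow> ?R" by blast
    finally show ?thesis .
  qed
  then show ?thesis
    unfolding Q.cyclic_group by (auto simp: carrier_FactGroup)
qed

lemma (in normal) rcos_diff:
  fixes m n :: int
  assumes "x \<in> carrier G" "y \<in> carrier G" "a \<in> carrier G"
    and "H #> x = H #> a [^] m" "H #> y = H #> a [^] n"
  shows "H #> (x \<otimes> inv y) = H #> a [^] (m - n)"
proof -
  have "H #> (x \<otimes> inv y) = (H #> x) <#> set_inv (H #> y)"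
    using assms(1,2) by (simp add: rcos_inv rcos_sum)
  also have "\<dots> = H #> (a [^] m \<otimes> inv (a [^] n))"
    using assms by (simp add: rcos_inv rcos_sum)
  finally show ?thesis using assms(3) by (simp add: int_pow_diff)
qed

text \<open>The exponents realised by a subgroup are closed under subtraction, so they form an ideal of
  the integers. For \<open>S\<close> the trivial group, \<open>d\<close> is the order of \<open>a\<close> modulo \<open>H\<close>, with \<open>d = 0\<close> for
  infinite order.\<close>

lemma (in normal) exponents_multiples:
  assumes S: "subgroup S G" and a: "a \<in> carrier G"
  obtains d where "d \<ge> 0" "{n::int. \<exists>s\<in>S. H #> s = H #> a [^] n} = {n. d dvd n}"
proof (rule int_subgroup_multiples)
  show "0 \<in> {n::int. \<exists>s\<in>S. H #> s = H #> a [^] n}"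
    using subgroup.one_closed[OF S] by auto
  show "m - n \<in> {n::int. \<exists>s\<in>S. H #> s = H #> a [^] n}"
    if "m \<in> {n::int. \<exists>s\<in>S. H #> s = H #> a [^] n}"
      "n \<in> {n::int. \<exists>s\<in>S. H #> s = H #> a [^] n}" for m n
  proof -
    from that obtain s t where st: "s \<in> S" "H #> s = H #> a [^] m" "t \<in> S" "H #> t = H #> a [^] n"
      by blast
    then have "H #> (s \<otimes> inv t) = H #> a [^] (m - n)"
      using rcos_diff[OF _ _ a] subgroup.mem_carrier[OF S] by simp
    moreover have "s \<otimes> inv t \<in> S"
      using st S by (simp add: subgroup.m_closed subgroup.m_inv_closed)
    ultimately show ?thesis by blast
  qed
qed (rule that)

text \<open>\<open>S\<close> modulo \<open>H \<inter> S\<close> embeds into the cyclic quotient by \<open>H\<close>; a generator is an element of \<open>S\<close>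
  whose exponent generates the ideal of exponents realised by \<open>S\<close>.\<close>

lemma (in normal) cyclic_FactGroup_subgroup:
  assumes S: "subgroup S G" and cyc: "cyclic_group (G Mod H)"
  shows "H \<inter> S \<lhd> G\<lparr>carrier := S\<rparr>" "cyclic_group (G\<lparr>carrier := S\<rparr> Mod (H \<inter> S))"
proof -
  interpret S: subgroup S G by (rule S)
  interpret GS: group "G\<lparr>carrier := S\<rparr>" by (rule subgroup_imp_group[OF S])
  have HS: "subgroup (H \<inter> S) (G\<lparr>carrier := S\<rparr>)"
    by (rule subgroup_incl[OF subgroups_Inter_pair[OF subgroup_axioms S] S]) auto
  show N: "H \<inter> S \<lhd> G\<lparr>carrier := S\<rparr>"
    unfolding GS.normal_inv_iff
  proof (intro conjI HS ballI)
    fix x h assume x: "x \<in> carrier (G\<lparr>carrier := S\<rparr>)" and h: "h \<in> H \<inter> S"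
    have "x \<otimes> h \<otimes> inv x \<in> H" using x h S.mem_carrier inv_op_closed2 by simp
    moreover have "x \<otimes> h \<otimes> inv x \<in> S" using x h by simp
    ultimately show "x \<otimes>\<^bsub>G\<lparr>carrier := S\<rparr>\<^esub> h \<otimes>\<^bsub>G\<lparr>carrier := S\<rparr>\<^esub> inv\<^bsub>G\<lparr>carrier := S\<rparr>\<^esub> x \<in> H \<inter> S"
      using x m_inv_consistent[OF S] by simp
  qed
  interpret N: normal "H \<inter> S" "G\<lparr>carrier := S\<rparr>" by (rule N)
  obtain a where a: "a \<in> carrier G" "\<forall>x\<in>carrier G. \<exists>n::int. H #> x = H #> a [^] n"
    using cyc cyclic_FactGroup_iff by blast
  obtain d where "d \<ge> 0" and d: "{n::int. \<exists>s\<in>S. H #> s = H #> a [^] n} = {n. d dvd n}"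
    by (rule exponents_multiples[OF S a(1)])
  have "d \<in> {n::int. \<exists>s\<in>S. H #> s = H #> a [^] n}" by (simp only: d mem_Collect_eq dvd_refl)
  then obtain s where s: "s \<in> S" "H #> s = H #> a [^] d" by blast
  have "\<exists>n::int. (H \<inter> S) #>\<^bsub>G\<lparr>carrier := S\<rparr>\<^esub> x
      = (H \<inter> S) #>\<^bsub>G\<lparr>carrier := S\<rparr>\<^esub> s [^]\<^bsub>G\<lparr>carrier := S\<rparr>\<^esub> n" if x: "x \<in> S" for x
  proof -
    obtain n :: int where n: "H #> x = H #> a [^] n" using a(2) S.mem_carrier[OF x] by blast
    then have "n \<in> {n::int. \<exists>s\<in>S. H #> s = H #> a [^] n}" using x by blast
    then obtain m where m: "n = d * m" unfolding d by (auto elim: dvdE)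
    have "H #> s [^] m = H #> (a [^] d) [^] m"
      unfolding FactGroup_int_pow[OF S.mem_carrier[OF s(1)], symmetric]
        FactGroup_int_pow[OF int_pow_closed[OF a(1)], symmetric] s(2) ..
    then have eq: "H #> x = H #> s [^] m" using n m a(1) by (simp add: int_pow_pow)
    have sm: "s [^] m \<in> S" using subgroup_int_pow_closed[OF S s(1)] .
    have "x \<otimes> inv (s [^] m) \<in> H"
      using rcos_module_imp[OF is_group, of "s [^] m" x] eq x sm rcos_eq_iff by auto
    then have "x \<in> (H \<inter> S) #> s [^] m"
      using x sm unfolding r_coset_def
      by (intro UN_I[of "x \<otimes> inv (s [^] m)"]) (auto simp: m_assoc)
    then have "x \<in> (H \<inter> S) #>\<^bsub>G\<lparr>carrier := S\<rparr>\<^esub> s [^]\<^bsub>G\<lparr>carrier := S\<rparr>\<^esub> m"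
      by (simp add: r_coset_def int_pow_consistent[OF S s(1), symmetric])
    then show ?thesis
      using N.rcos_eq_iff[of x "s [^]\<^bsub>G\<lparr>carrier := S\<rparr>\<^esub> m"] x sm
      by (auto simp: int_pow_consistent[OF S s(1), symmetric])
  qed
  then show "cyclic_group (G\<lparr>carrier := S\<rparr> Mod (H \<inter> S))"
    unfolding N.cyclic_FactGroup_iff using s(1) by auto
qed

lemma (in group) polycyclic_seq_imp_subgroup: "polycyclic_seq G H \<Longrightarrow> subgroup H G"
  by (induction rule: polycyclic_seq.induct) (auto simp: triv_subgroup)

text \<open>Intersecting a polycyclic series termwise with a subgroup gives a polycyclic series, so
  subgroups of polycyclic groups are polycyclic.\<close>

lemma (in group) polycyclic_seq_Int:
  assumes "polycyclic_seq G H" and S: "subgroup S G"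
  shows "polycyclic_seq G (H \<inter> S)"
  using assms(1)
proof (induction rule: polycyclic_seq.induct)
  case unity
  then show ?case using polycyclic_seq.unity[of G] subgroup.one_closed[OF S] by simp
next
  case (extension K H)
  interpret K: normal K "G\<lparr>carrier := H\<rparr>" by (rule extension)
  have sub: "subgroup (H \<inter> S) G" using extension S subgroups_Inter_pair by blast
  have HS: "subgroup (H \<inter> S) (G\<lparr>carrier := H\<rparr>)"
    by (rule subgroup_incl[OF sub]) (use extension in auto)
  have KS: "K \<inter> (H \<inter> S) = K \<inter> S" using K.subset by auto
  show ?case
    using polycyclic_seq.extension[OF extension.IH sub] K.cyclic_FactGroup_subgroup[OF HS]
      extension(4) by (simp add: KS)
qed

lemma (in group) polycyclic_seq_subgroup:
  assumes "polycyclic_seq G H" "subgroup S G" "S \<subseteq> H"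
  shows "polycyclic_seq G S"
  using polycyclic_seq_Int[OF assms(1,2)] assms(3) by (simp add: Int_absorb1)

lemma (in group) polycyclic_seq_restrict:
  assumes A: "subgroup A G" and "polycyclic_seq (G\<lparr>carrier := A\<rparr>) H"
  shows "polycyclic_seq G H"
  using assms(2)
proof (induction rule: polycyclic_seq.induct)
  case unity
  then show ?case using polycyclic_seq.unity[of G] by simp
next
  case (extension K H)
  then show ?case
    using polycyclic_seq.extension[OF extension.IH incl_subgroup[OF A]] by simp
qed

text \<open>The form in which a series is extended below: normality and cyclicity are statements about
  elements of \<open>G\<close> itself.\<close>

lemma (in group) polycyclic_seq_cyclic_extension:
  assumes K: "polycyclic_seq G K" and H: "subgroup H G" and KH: "K \<subseteq> H"
    and conj: "\<And>h k. \<lbrakk>h \<in> H; k \<in> K\<rbrakk> \<Longrightarrow> h \<otimes> k \<otimes> inv h \<in> K"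
    and a: "a \<in> H" and cyc: "\<And>x. x \<in> H \<Longrightarrow> \<exists>n::int. x \<in> K #> a [^] n"
  shows "polycyclic_seq G H"
proof -
  interpret GH: group "G\<lparr>carrier := H\<rparr>" by (rule subgroup_imp_group[OF H])
  have N: "K \<lhd> G\<lparr>carrier := H\<rparr>"
    unfolding GH.normal_inv_iff
    using subgroup_incl[OF polycyclic_seq_imp_subgroup[OF K] H KH] conj H by simp
  interpret N: normal K "G\<lparr>carrier := H\<rparr>" by (rule N)
  have "\<exists>n::int. K #>\<^bsub>G\<lparr>carrier := H\<rparr>\<^esub> x = K #>\<^bsub>G\<lparr>carrier := H\<rparr>\<^esub> a [^]\<^bsub>G\<lparr>carrier := H\<rparr>\<^esub> n"
    if x: "x \<in> H" for x
  proof -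
    obtain n :: int where "x \<in> K #> a [^] n" using cyc[OF x] by blast
    then have "x \<in> K #>\<^bsub>G\<lparr>carrier := H\<rparr>\<^esub> a [^]\<^bsub>G\<lparr>carrier := H\<rparr>\<^esub> n"
      by (simp add: r_coset_def int_pow_consistent[OF H a, symmetric])
    then show ?thesis
      using N.rcos_eq_iff x subgroup_int_pow_closed[OF H a]
      by (auto simp: int_pow_consistent[OF H a, symmetric])
  qed
  then have "cyclic_group (G\<lparr>carrier := H\<rparr> Mod K)"
    unfolding N.cyclic_FactGroup_iff using a by auto
  then show ?thesis by (rule polycyclic_seq.extension[OF K H N])
qed

section \<open>Groups acting by monotone lifts\<close>

text \<open>\<open>F\<close> maps the finitely many points of \<open>D\<close> between \<open>v\<close> and \<open>x\<close> bijectively onto those between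
  \<open>v\<close> and \<open>F x\<close>. One of these two finite sets contains the other, so they are equal, and comparing
  their extreme points gives \<open>F x = x\<close>.\<close>

lemma strict_mono_bij_fixes_locally_finite_set:
  fixes F :: "real \<Rightarrow> real"
  assumes F: "bij F" "strict_mono F" and D: "\<And>t. F t \<in> D \<longleftrightarrow> t \<in> D"
    and fin: "\<And>a b. finite (D \<inter> {a..b})" and v: "F v = v" and x: "x \<in> D"
  shows "F x = x"
proof -
  have image: "F ` (D \<inter> {a..b}) = D \<inter> {F a..F b}" for a b
  proof (intro equalityI subsetI)
    fix y assume y: "y \<in> D \<inter> {F a..F b}"
    obtain t where "y = F t" using F(1) by (metis bij_pointE)
    then show "y \<in> F ` (D \<inter> {a..b})"
      using y D[of t] strict_mono_less_eq[OF F(2)] by auto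
  qed (use D strict_mono_less_eq[OF F(2)] in auto)
  have card: "card (D \<inter> {F a..F b}) = card (D \<inter> {a..b})" for a b
    unfolding image[symmetric]
    by (rule card_image) (use F(1) in \<open>auto simp: bij_def intro: inj_on_subset\<close>)
  have Fx: "F x \<in> D" using D x by simp
  show ?thesis
  proof (cases "v \<le> x")
    case True
    then have le: "v \<le> F x" using strict_mono_less_eq[OF F(2), of v x] v by simp
    have "D \<inter> {v..F x} \<subseteq> D \<inter> {v..x} \<or> D \<inter> {v..x} \<subseteq> D \<inter> {v..F x}" by auto
    then have eq: "D \<inter> {v..F x} = D \<inter> {v..x}"
      using card_subset_eq[OF fin[of v x]] card_subset_eq[OF fin[of v "F x"]] card[of v x]
      unfolding v by metis
    have "F x \<in> D \<inter> {v..x}" unfolding eq[symmetric] using Fx le by simp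
    moreover have "x \<in> D \<inter> {v..F x}" unfolding eq using x True by simp
    ultimately show ?thesis by simp
  next
    case False
    then have le: "F x \<le> v" using strict_mono_less_eq[OF F(2), of x v] v by simp
    have "D \<inter> {F x..v} \<subseteq> D \<inter> {x..v} \<or> D \<inter> {x..v} \<subseteq> D \<inter> {F x..v}" by auto
    then have eq: "D \<inter> {F x..v} = D \<inter> {x..v}"
      using card_subset_eq[OF fin[of x v]] card_subset_eq[OF fin[of "F x" v]] card[of x v]
      unfolding v by metis
    have "F x \<in> D \<inter> {x..v}" unfolding eq[symmetric] using Fx le by simp
    moreover have "x \<in> D \<inter> {F x..v}" unfolding eq using x False by simp
    ultimately show ?thesis by simp
  qed
qed

text \<open>The abstract situation produced by an action on a line or a circle. \<open>L g\<close> is the set of all lifts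
  of \<open>g\<close> to the line: one map when the space is a line, infinitely many (differing by integer
  translations) when it is a circle. Working with the whole set of lifts treats both cases at once
  and avoids introducing the group of all lifts, or orientations of a circle. \<open>D\<close> is the preimage of
  the set of vertices.\<close>

locale monotone_lifting = group G for G (structure) +
  fixes L :: "'a \<Rightarrow> (real \<Rightarrow> real) set" and D :: "real set"
  assumes lift_exists: "g \<in> carrier G \<Longrightarrow> \<exists>F. F \<in> L g"
    and lift_one: "id \<in> L \<one>"
    and lift_mult: "\<lbrakk>g \<in> carrier G; h \<in> carrier G; E \<in> L g; F \<in> L h\<rbrakk> \<Longrightarrow> E \<circ> F \<in> L (g \<otimes> h)"
    and lift_inv: "\<lbrakk>g \<in> carrier G; F \<in> L g\<rbrakk> \<Longrightarrow> inv_into UNIV F \<in> L (inv g)"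
    and lift_bij: "\<lbrakk>g \<in> carrier G; F \<in> L g\<rbrakk> \<Longrightarrow> bij F"
    and lift_monotone: "\<lbrakk>g \<in> carrier G; F \<in> L g\<rbrakk> \<Longrightarrow> strict_mono F \<or> strict_antimono_on UNIV F"
    and lift_marked: "\<lbrakk>g \<in> carrier G; F \<in> L g\<rbrakk> \<Longrightarrow> F t \<in> D \<longleftrightarrow> t \<in> D"
    and finite_marked: "finite (D \<inter> {a..b})"
begin

definition increasing_lift :: "'a \<Rightarrow> (real \<Rightarrow> real) \<Rightarrow> bool"
  where "increasing_lift g F \<longleftrightarrow> g \<in> carrier G \<and> F \<in> L g \<and> strict_mono F"

definition orientation_preserving :: "'a set"
  where "orientation_preserving = {g. \<exists>F. increasing_lift g F}"

text \<open>In general smaller than the stabilizer of the point below \<open>v\<close>: it excludes the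
  orientation-reversing elements, which need not fix the other marked points.\<close>

definition fixer :: "real \<Rightarrow> 'a set"
  where "fixer v = {g. \<exists>F. increasing_lift g F \<and> F v = v}"

lemma increasing_lift_one: "increasing_lift \<one> id"
  by (auto simp: increasing_lift_def lift_one strict_mono_def)

lemma increasing_lift_mult:
  "\<lbrakk>increasing_lift g E; increasing_lift h F\<rbrakk> \<Longrightarrow> increasing_lift (g \<otimes> h) (E \<circ> F)"
  by (auto simp: increasing_lift_def lift_mult strict_mono_def)

lemma lift_inv_apply:
  assumes "g \<in> carrier G" "F \<in> L g"
  shows "inv_into UNIV F (F t) = t" "F (inv_into UNIV F t) = t"
  using lift_bij[OF assms] by (simp_all add: bij_is_inj bij_is_surj surj_f_inv_f)

lemma increasing_lift_inv:
  assumes "increasing_lift g F"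
  shows "increasing_lift (inv g) (inv_into UNIV F)"
proof -
  have F: "g \<in> carrier G" "F \<in> L g" "strict_mono F" using assms by (auto simp: increasing_lift_def)
  have "strict_mono (inv_into UNIV F)"
    using strict_mono_inv[OF F(3) bij_is_surj[OF lift_bij[OF F(1,2)]]] lift_inv_apply[OF F(1,2)]
    by blast
  then show ?thesis using F lift_inv by (simp add: increasing_lift_def)
qed

text \<open>Conjugation by an order-reversing bijection reverses the order twice, so \<open>E\<close> may be any lift.\<close>

lemma increasing_lift_conj:
  assumes h: "h \<in> carrier G" "E \<in> L h" and k: "increasing_lift k F"
  shows "increasing_lift (h \<otimes> k \<otimes> inv h) (E \<circ> F \<circ> inv_into UNIV E)"
proof -
  have F: "k \<in> carrier G" "F \<in> L k" "strict_mono F" using k by (auto simp: increasing_lift_def)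
  have "E (F (inv_into UNIV E s)) < E (F (inv_into UNIV E t))" if "s < t" for s t
  proof -
    have "E (inv_into UNIV E s) < E (inv_into UNIV E t)"
      using that by (simp add: lift_inv_apply[OF h])
    then show ?thesis
      using lift_monotone[OF h] strict_monoD[OF F(3)]
      by (smt (verit) monotone_on_def strict_mono_less UNIV_I)
  qed
  then show ?thesis
    using h F by (auto simp: increasing_lift_def lift_mult lift_inv strict_mono_def)
qed

lemma subgroup_orientation_preserving: "subgroup orientation_preserving G"
proof (rule subgroupI)
  show "orientation_preserving \<subseteq> carrier G"
    by (auto simp: orientation_preserving_def increasing_lift_def)
qed (use increasing_lift_one increasing_lift_mult increasing_lift_inv in
    \<open>unfold orientation_preserving_def, blast+\<close>)

lemma subgroup_fixer: "subgroup (fixer v) G"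
proof (rule subgroupI)
  show "fixer v \<subseteq> carrier G" by (auto simp: fixer_def increasing_lift_def)
  show "fixer v \<noteq> {}" using increasing_lift_one by (force simp: fixer_def)
  show "inv g \<in> fixer v" if g: "g \<in> fixer v" for g
  proof -
    obtain F where F: "increasing_lift g F" "F v = v" using g by (auto simp: fixer_def)
    then have "inv_into UNIV F v = v"
      using lift_inv_apply(1)[of g F v] by (simp add: increasing_lift_def)
    then show ?thesis using increasing_lift_inv[OF F(1)] by (auto simp: fixer_def)
  qed
  show "g \<otimes> h \<in> fixer v" if "g \<in> fixer v" "h \<in> fixer v" for g h
    using that increasing_lift_mult by (force simp: fixer_def)
qed

lemma fixer_subset: "fixer v \<subseteq> orientation_preserving"
  by (auto simp: fixer_def orientation_preserving_def)

text \<open>An increasing lift that fixes \<open>v\<close> fixes all of \<open>D\<close>, in particular every image of \<open>v\<close>.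
  This is why the point stabilizer is normal among the orientation-preserving elements.\<close>

lemma fixer_conj:
  assumes v: "v \<in> D" and h: "h \<in> orientation_preserving" and k: "k \<in> fixer v"
  shows "h \<otimes> k \<otimes> inv h \<in> fixer v"
proof -
  obtain E where E: "increasing_lift h E" using h by (auto simp: orientation_preserving_def)
  obtain F where F: "increasing_lift k F" "F v = v" using k by (auto simp: fixer_def)
  have hE: "h \<in> carrier G" "E \<in> L h" using E by (auto simp: increasing_lift_def)
  have kF: "k \<in> carrier G" "F \<in> L k" "strict_mono F" using F by (auto simp: increasing_lift_def)
  have "inv_into UNIV E v \<in> D"
    using lift_marked[OF hE, of "inv_into UNIV E v"] lift_inv_apply[OF hE] v by simp
  then have "F (inv_into UNIV E v) = inv_into UNIV E v"
    using strict_mono_bij_fixes_locally_finite_set[OF lift_bij[OF kF(1,2)] kF(3)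
        lift_marked[OF kF(1,2)] finite_marked F(2)] by blast
  then have "(E \<circ> F \<circ> inv_into UNIV E) v = v" using lift_inv_apply[OF hE] by simp
  then show ?thesis using increasing_lift_conj[OF hE F(1)] by (auto simp: fixer_def)
qed

text \<open>A generator \<open>a\<close> is an element moving \<open>v\<close> to the next point \<open>w\<close> of its orbit. If \<open>g\<close> moves \<open>v\<close> to
  the right, then multiplying \<open>g\<close> by the inverse of \<open>a\<close> brings the image of \<open>v\<close> closer to \<open>v\<close>
  without passing it, and the number of points of \<open>D\<close> in between measures the progress.\<close>

lemma orientation_preserving_cyclic_over_fixer:
  assumes v: "v \<in> D"
  obtains a where "a \<in> orientation_preserving"
    "\<And>g. g \<in> orientation_preserving \<Longrightarrow> \<exists>n::int. g \<in> fixer v #> a [^] n"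
proof (cases "orientation_preserving \<subseteq> fixer v")
  case True
  have "g \<in> fixer v #> \<one> [^] (0::int)" if "g \<in> orientation_preserving" for g
    using True that subgroup.subset[OF subgroup_fixer] by (auto simp: coset_mult_one)
  then show ?thesis using that subgroup.one_closed[OF subgroup_orientation_preserving] by blast
next
  case False
  then obtain g1 F1 where 1: "increasing_lift g1 F1" "F1 v \<noteq> v"
    by (auto simp: orientation_preserving_def fixer_def)
  define Orb where "Orb = {F v | g F. increasing_lift g F}"
  have Orb_D: "Orb \<subseteq> D" using v lift_marked by (auto simp: Orb_def increasing_lift_def)
  have "\<exists>y\<in>Orb. v < y"
  proof (cases "v < F1 v")
    case True
    then show ?thesis using 1 by (auto simp: Orb_def)
  next
    case False
    have "v < inv_into UNIV F1 v"
      using False 1 strict_mono_less[of F1 v "inv_into UNIV F1 v"] lift_inv_apply[of g1 F1 v]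
      by (auto simp: increasing_lift_def)
    then show ?thesis using increasing_lift_inv[OF 1(1)] by (auto simp: Orb_def)
  qed
  then obtain y where y: "y \<in> Orb" "v < y" by blast
  have fin: "finite (Orb \<inter> {v<..y})"
    by (rule finite_subset[OF _ finite_marked[of v y]]) (use Orb_D in auto)
  \<comment> \<open>The cut at \<open>y\<close> makes the set finite, so that the minimum exists.\<close>
  define w where "w = Min (Orb \<inter> {v<..y})"
  have w: "w \<in> Orb" "v < w" "w \<le> y"
    using Min_in[OF fin] y by (force simp: w_def)+
  have w_min: "w \<le> x" if "x \<in> Orb" "v < x" for x
  proof (cases "x \<le> y")
    case True
    then show ?thesis unfolding w_def using fin that by (intro Min_le) auto
  next
    case False
    then show ?thesis using w by simp
  qed
  obtain a A where A: "increasing_lift a A" "w = A v" using w(1) by (auto simp: Orb_def)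
  have a: "a \<in> carrier G" "A \<in> L a" "strict_mono A" using A(1) by (auto simp: increasing_lift_def)
  have a_op: "a \<in> orientation_preserving" using A by (auto simp: orientation_preserving_def)
  let ?K = "fixer v"
  have up: "\<exists>n::int. g \<in> ?K #> a [^] n" if "increasing_lift g F" "v \<le> F v" for g F
    using that
  proof (induction "card (D \<inter> {v..F v})" arbitrary: g F rule: less_induct)
    case less
    have gF: "g \<in> carrier G" "F \<in> L g" using less.prems by (auto simp: increasing_lift_def)
    show ?case
    proof (cases "F v = v")
      case True
      then have "g \<in> ?K" using less.prems by (auto simp: fixer_def)
      then have "g \<in> ?K #> a [^] (0::int)"
        using subgroup.subset[OF subgroup_fixer] by (simp add: coset_mult_one)
      then show ?thesis ..
    next
      case False
      define F' where "F' = inv_into UNIV A \<circ> F"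
      have lift: "increasing_lift (inv a \<otimes> g) F'"
        unfolding F'_def by (rule increasing_lift_mult[OF increasing_lift_inv[OF A(1)] less.prems(1)])
      have AF': "A (F' v) = F v" by (simp add: F'_def lift_inv_apply[OF a(1,2)])
      have "A v \<le> A (F' v)"
        unfolding AF' using w_min[of "F v"] A(2) less.prems False by (auto simp: Orb_def)
      then have le: "v \<le> F' v" by (simp add: strict_mono_less_eq[OF a(3)])
      have "card (D \<inter> {v..F' v}) = card (A ` (D \<inter> {v..F' v}))"
        using lift_bij[OF a(1,2)] by (intro card_image[symmetric]) (auto simp: bij_def intro: inj_on_subset)
      also have "\<dots> < card (D \<inter> {v..F v})"
      proof (rule psubset_card_mono[OF finite_marked])
        \<comment> \<open>\<open>A\<close> shifts the remaining interval off its left end \<open>v\<close>, since \<open>w = A v > v\<close>.\<close>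
        have "A ` (D \<inter> {v..F' v}) \<subseteq> D \<inter> {w..F v}"
          using lift_marked[OF a(1,2)] strict_mono_less_eq[OF a(3)]
          by (auto simp: A(2) AF'[symmetric])
        moreover have "D \<inter> {w..F v} \<subset> D \<inter> {v..F v}"
        proof
          show "D \<inter> {w..F v} \<subseteq> D \<inter> {v..F v}" using w(2) by auto
          have "v \<in> D \<inter> {v..F v}" "v \<notin> D \<inter> {w..F v}" using v less.prems(2) w(2) by auto
          then show "D \<inter> {w..F v} \<noteq> D \<inter> {v..F v}" by blast
        qed
        ultimately show "A ` (D \<inter> {v..F' v}) \<subset> D \<inter> {v..F v}" by (rule subset_psubset_trans)
      qed
      finally obtain n :: int where "inv a \<otimes> g \<in> ?K #> a [^] n"
        using less.hyps[OF _ lift le] by blast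
      then obtain k where k: "k \<in> ?K" "inv a \<otimes> g = k \<otimes> a [^] n"
        by (auto simp: r_coset_def)
      have kc: "k \<in> carrier G" using k(1) subgroup.subset[OF subgroup_fixer] by blast
      \<comment> \<open>Cosets are right cosets, so \<open>k\<close> is moved to the left of \<open>a\<close> by conjugation.\<close>
      have "g = a \<otimes> (inv a \<otimes> g)" using a gF by (simp add: m_assoc[symmetric])
      also have "\<dots> = (a \<otimes> k \<otimes> inv a) \<otimes> (a \<otimes> a [^] n)"
        using a kc k(2) by (simp add: m_assoc) (simp add: m_assoc[symmetric])
      also have "a \<otimes> a [^] n = a [^] (1 + n)" using a by (simp only: int_pow_mult int_pow_1)
      finally have "g \<in> ?K #> a [^] (1 + n)"
        using fixer_conj[OF v a_op k(1)] by (auto simp: r_coset_def)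
      then show ?thesis ..
    qed
  qed
  have "\<exists>n::int. g \<in> ?K #> a [^] n" if g: "g \<in> orientation_preserving" for g
  proof -
    obtain F where F: "increasing_lift g F" using g by (auto simp: orientation_preserving_def)
    have gF: "g \<in> carrier G" "F \<in> L g" "strict_mono F" using F by (auto simp: increasing_lift_def)
    show ?thesis
    proof (cases "v \<le> F v")
      case True
      then show ?thesis using up F by blast
    next
      case False
      have "v \<le> inv_into UNIV F v"
        using False strict_mono_less_eq[OF gF(3), of v "inv_into UNIV F v"] lift_inv_apply[OF gF(1,2)]
        by simp
      then obtain n :: int where "inv g \<in> ?K #> a [^] n"
        using up[OF increasing_lift_inv[OF F]] by blast
      then obtain k where k: "k \<in> ?K" "inv g = k \<otimes> a [^] n" by (auto simp: r_coset_def)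
      have kc: "k \<in> carrier G" using k(1) subgroup.subset[OF subgroup_fixer] by blast
      have "g = inv (inv g)" using gF by simp
      also have "\<dots> = (a [^] (- n) \<otimes> inv k \<otimes> inv (a [^] (- n))) \<otimes> a [^] (- n)"
        using a kc unfolding k(2) by (simp add: inv_mult_group m_assoc int_pow_neg)
      finally have "g \<in> ?K #> a [^] (- n)"
        using fixer_conj[OF v subgroup_int_pow_closed[OF subgroup_orientation_preserving a_op, of "- n"]
            subgroup.m_inv_closed[OF subgroup_fixer k(1)]] by (auto simp: r_coset_def)
      then show ?thesis ..
    qed
  qed
  then show ?thesis using that a_op by blast
qed

text \<open>The series is the given one for the fixer of \<open>v\<close>, followed by the orientation-preserving
  subgroup and the whole group. The last quotient has order at most two, because a product of two
  order-reversing maps is order-preserving.\<close>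

lemma polycyclic_if_fixer_polycyclic:
  assumes v: "v \<in> D" and K: "polycyclic_seq G (fixer v)"
  shows "polycyclic_seq G (carrier G)"
proof -
  let ?P = orientation_preserving
  obtain a where "a \<in> ?P" "\<And>g. g \<in> ?P \<Longrightarrow> \<exists>n::int. g \<in> fixer v #> a [^] n"
    using orientation_preserving_cyclic_over_fixer[OF v] by blast
  then have P: "polycyclic_seq G ?P"
    using polycyclic_seq_cyclic_extension[OF K subgroup_orientation_preserving fixer_subset
        fixer_conj[OF v]] by blast
  have conj: "h \<otimes> k \<otimes> inv h \<in> ?P" if "h \<in> carrier G" "k \<in> ?P" for h k
    using that lift_exists[of h] increasing_lift_conj unfolding orientation_preserving_def by blast
  have quot: "g \<otimes> inv b \<in> ?P" if gb: "g \<in> carrier G - ?P" "b \<in> carrier G - ?P" for g b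
  proof -
    obtain E F where E: "E \<in> L g" and F: "F \<in> L b" using lift_exists gb by blast
    have "strict_antimono_on UNIV E" "strict_antimono_on UNIV F"
      using gb E F lift_monotone by (auto simp: orientation_preserving_def increasing_lift_def)
    have "E (inv_into UNIV F s) < E (inv_into UNIV F t)" if "s < t" for s t
    proof -
      have "F (inv_into UNIV F s) < F (inv_into UNIV F t)"
        using that lift_inv_apply(2)[OF _ F] gb by simp
      then have "inv_into UNIV F t < inv_into UNIV F s"
        using monotone_onD[OF \<open>strict_antimono_on UNIV F\<close>, of "inv_into UNIV F s" "inv_into UNIV F t"]
        by (cases "inv_into UNIV F s" "inv_into UNIV F t" rule: linorder_cases) auto
      then show ?thesis using \<open>strict_antimono_on UNIV E\<close> by (simp add: monotone_on_def)
    qed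
    then have "increasing_lift (g \<otimes> inv b) (E \<circ> inv_into UNIV F)"
      using gb E F by (auto simp: increasing_lift_def lift_mult lift_inv strict_mono_def)
    then show ?thesis by (auto simp: orientation_preserving_def)
  qed
  obtain b where b: "b \<in> carrier G" "\<And>g. g \<in> carrier G - ?P \<Longrightarrow> g \<otimes> inv b \<in> ?P"
    using quot one_closed by (cases "carrier G \<subseteq> ?P") blast+
  have "\<exists>n::int. g \<in> ?P #> b [^] n" if g: "g \<in> carrier G" for g
  proof (cases "g \<in> ?P")
    case True
    then have "g \<in> ?P #> b [^] (0::int)"
      using subgroup.subset[OF subgroup_orientation_preserving] by (simp add: coset_mult_one)
    then show ?thesis ..
  next
    case False
    then have "g \<otimes> inv b \<in> ?P" using b g by blast
    moreover have "g = g \<otimes> inv b \<otimes> b" using g b by (simp add: m_assoc)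
    ultimately have "g \<in> ?P #> b [^] (1::int)" using b by (auto simp: r_coset_def)
    then show ?thesis ..
  qed
  then show ?thesis
    using polycyclic_seq_cyclic_extension[OF P subgroup_self subgroup.subset conj b(1)]
      subgroup_orientation_preserving by blast
qed

end

section \<open>Quotients of the line by translations\<close>

text \<open>\<open>X\<close> is the quotient of the line by translation by multiples of \<open>n\<close>: a line for \<open>n = 0\<close> and a
  circle of length \<open>n\<close> for \<open>n > 0\<close>. Admitting \<open>n = 0\<close> lets one argument serve both spaces.\<close>

definition line_quotient :: "nat \<Rightarrow> 'x topology \<Rightarrow> (real \<Rightarrow> 'x) \<Rightarrow> bool"
  where "line_quotient n X p \<longleftrightarrow> quotient_map euclideanreal X p \<and>
    (\<forall>s t. p s = p t \<longleftrightarrow> (\<exists>j::int. s - t = of_int j * real n))"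

lemma line_quotient_compose_homeomorphic:
  assumes "line_quotient n X p" "homeomorphic_map X Y h"
  shows "line_quotient n Y (h \<circ> p)"
  unfolding line_quotient_def
proof (intro conjI allI)
  have p: "quotient_map euclideanreal X p" using assms(1) by (simp add: line_quotient_def)
  show "quotient_map euclideanreal Y (h \<circ> p)"
    using quotient_map_compose[OF p] assms(2) unfolding homeomorphic_map_def by blast
  have "p t \<in> topspace X" for t using quotient_imp_surjective_map[OF p] by auto
  then have "h (p s) = h (p t) \<longleftrightarrow> p s = p t" for s t
    using assms(2) by (auto simp: homeomorphic_map_def inj_on_eq_iff)
  then show "(h \<circ> p) s = (h \<circ> p) t \<longleftrightarrow> (\<exists>j::int. s - t = of_int j * real n)" for s t
    using assms(1) by (simp add: line_quotient_def)
qed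

lemma line_quotient_homeomorphism:
  assumes "homeomorphic_map euclideanreal X p"
  shows "line_quotient 0 X p"
  using assms by (auto simp: line_quotient_def homeomorphic_map_def inj_on_def)

lemma cis_eq_cis_iff: "cis a = cis b \<longleftrightarrow> (\<exists>j::int. a - b = of_int j * (2 * pi))"
proof -
  have "cis a = cis b \<longleftrightarrow> cis (a - b) = 1"
    unfolding cis_divide[symmetric] by simp
  also have "\<dots> \<longleftrightarrow> cos (a - b) = 1"
    using cos_one_sin_zero[of "a - b"] by (auto simp: complex_eq_iff)
  also have "\<dots> \<longleftrightarrow> (\<exists>j::int. a - b = of_int j * (2 * pi))"
    unfolding cos_one_2pi_int by (simp add: mult.assoc)
  finally show ?thesis .
qed

text \<open>The map is a quotient map because a saturated closed set is determined by its part in the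
  compact interval \<open>{0..n}\<close>, whose image is compact and hence closed.\<close>

lemma line_quotient_circle:
  assumes n: "n > 0"
  shows "line_quotient n (top_of_set (sphere (0::complex) 1)) (\<lambda>t. cis (2 * pi * t / real n))"
    (is "line_quotient n ?X ?p")
  unfolding line_quotient_def
proof (intro conjI allI)
  have cont: "continuous_map euclideanreal ?X ?p"
    using n by (auto simp: continuous_map_in_subtopology intro!: continuous_intros)
  have rep: "\<exists>t\<in>{0..real n}. z = ?p t" if "z \<in> sphere 0 1" for z
  proof -
    have z: "z = cis (Arg2pi z)" using that Arg2pi_eq[of z] by (simp add: cis_conv_exp)
    have "z = ?p (real n * Arg2pi z / (2 * pi))" using z n by simp
    moreover have "real n * Arg2pi z / (2 * pi) \<in> {0..real n}"
      using n Arg2pi_ge_0[of z] Arg2pi_lt_2pi[of z] by (auto simp: field_simps)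
    ultimately show ?thesis by blast
  qed
  show "quotient_map euclideanreal ?X ?p"
    unfolding quotient_map_closedin
  proof (intro conjI allI impI)
    show "?p ` topspace euclideanreal = topspace ?X"
      using rep continuous_map_image_subset_topspace[OF cont] by force
    fix U assume U: "U \<subseteq> topspace ?X"
    show "closedin euclideanreal {x \<in> topspace euclideanreal. ?p x \<in> U} = closedin ?X U"
    proof
      assume "closedin ?X U"
      then show "closedin euclideanreal {x \<in> topspace euclideanreal. ?p x \<in> U}"
        by (rule closedin_continuous_map_preimage[OF cont])
    next
      assume "closedin euclideanreal {x \<in> topspace euclideanreal. ?p x \<in> U}"
      then have "compact ({0..real n} \<inter> {x. ?p x \<in> U})"
        by (intro compact_Int_closed) auto
      then have "compact (?p ` ({0..real n} \<inter> {x. ?p x \<in> U}))"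
        using n by (intro compact_continuous_image continuous_intros) auto
      moreover have "?p ` ({0..real n} \<inter> {x. ?p x \<in> U}) = U"
        using rep U by fastforce
      ultimately show "closedin ?X U"
        using U by (simp add: closed_subset compact_imp_closed)
    qed
  qed
  show "?p s = ?p t \<longleftrightarrow> (\<exists>j::int. s - t = of_int j * real n)" for s t
  proof -
    have "2 * pi * s / n - 2 * pi * t / n = of_int j * (2 * pi) \<longleftrightarrow> s - t = of_int j * real n" for j :: int
    proof -
      have eq: "2 * pi * s / n - 2 * pi * t / n = (s - t) / n * (2 * pi)"
        using n by (simp add: field_simps)
      have "(s - t) / n * (2 * pi) = of_int j * (2 * pi) \<longleftrightarrow> (s - t) / n = of_int j"
        by (rule mult_right_cancel) simp
      then show ?thesis unfolding eq using n by (simp add: field_simps)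
    qed
    then show ?thesis unfolding cis_eq_cis_iff by simp
  qed
qed

lemma real_line_homeomorphic_map_of_real:
  "homeomorphic_map euclideanreal (top_of_set (range complex_of_real)) complex_of_real"
  unfolding homeomorphic_map_maps
  by (rule exI[of _ Re])
    (auto simp: homeomorphic_maps_def continuous_map_in_subtopology intro!: continuous_intros)

lemma line_quotient_exists:
  obtains X :: "complex topology" and p where "line_quotient n X p" "Hausdorff_space X"
    "X homeomorphic_space top_of_set (sphere (0::complex) 1) \<or> X homeomorphic_space (euclidean :: real topology)"
proof (cases "n = 0")
  case True
  have "line_quotient n (top_of_set (range complex_of_real)) complex_of_real"
    unfolding True by (rule line_quotient_homeomorphism[OF real_line_homeomorphic_map_of_real])
  moreover have "top_of_set (range complex_of_real) homeomorphic_space euclideanreal"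
    using homeomorphic_map_imp_homeomorphic_space[OF real_line_homeomorphic_map_of_real]
      homeomorphic_space_sym by blast
  ultimately show ?thesis using that Hausdorff_space_subtopology[OF Hausdorff_space_euclidean] by blast
next
  case False
  then show ?thesis
    using that line_quotient_circle[of n] Hausdorff_space_subtopology[OF Hausdorff_space_euclidean]
      homeomorphic_space_refl by blast
qed

lemma P4_homeomorphism_cases:
  assumes "X \<in> P4"
  obtains h where
    "homeomorphic_map (top_of_set (sphere (0::complex) 1)) (space X) h" |
    h where "homeomorphic_map euclideanreal (space X) h"
  using assms unfolding P4_def
  by (metis (no_types, lifting) homeomorphic_space homeomorphic_space_sym mem_Collect_eq)

section \<open>Lifting homeomorphisms\<close>

text \<open>Monotonicity is put in place of continuity, because it is what the order arguments use and it passes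
  to inverses at once.\<close>

definition lift :: "(real \<Rightarrow> 'x) \<Rightarrow> ('x \<Rightarrow> 'x) \<Rightarrow> (real \<Rightarrow> real) set"
  where "lift p f = {F. bij F \<and> (strict_mono F \<or> strict_antimono_on UNIV F) \<and> (\<forall>t. p (F t) = f (p t))}"

lemma liftI_continuous:
  assumes "bij F" "continuous_on UNIV F" "\<And>t. p (F t) = f (p t)"
  shows "F \<in> lift p f"
  using assms injective_eq_monotone_map[of UNIV F] by (simp add: lift_def bij_is_inj)

lemma line_lift_exists:
  assumes h: "homeomorphic_map euclideanreal X h" and f: "homeomorphic_map X X f"
  shows "\<exists>F. F \<in> lift h f"
proof -
  obtain h' where h': "homeomorphic_maps euclideanreal X h h'"
    using h homeomorphic_map_maps by blast
  then have "homeomorphic_map X euclideanreal h'"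
    by (simp add: homeomorphic_maps_map)
  then have F: "homeomorphic_map euclideanreal euclideanreal (h' \<circ> (f \<circ> h))"
    by (rule homeomorphic_map_compose[OF homeomorphic_map_compose[OF h f]])
  have "h t \<in> topspace X" for t
    using homeomorphic_imp_surjective_map[OF h] by auto
  then have "h ((h' \<circ> (f \<circ> h)) t) = f (h t)" for t
    using h' homeomorphic_imp_surjective_map[OF f] by (force simp: homeomorphic_maps_def)
  moreover have "bij (h' \<circ> (f \<circ> h))"
    using homeomorphic_imp_injective_map[OF F] homeomorphic_imp_surjective_map[OF F]
    by (simp add: bij_def)
  moreover have "continuous_on UNIV (h' \<circ> (f \<circ> h))"
    using homeomorphic_imp_continuous_map[OF F] by simp
  ultimately show ?thesis using liftI_continuous by blast
qed

text \<open>Covering-space lifting, through a continuous logarithm on the contractible line.\<close>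

lemma continuous_circle_lift:
  assumes "continuous_map (top_of_set (sphere (0::complex) 1)) (top_of_set (sphere 0 1)) f"
  obtains F where "continuous_on UNIV F" "\<And>t. cis (2 * pi * F t) = f (cis (2 * pi * t))"
proof -
  let ?u = "\<lambda>t::real. f (cis (2 * pi * t))"
  have f: "continuous_on (sphere 0 1) f" "f ` sphere 0 1 \<subseteq> sphere 0 1"
    using assms by auto
  have "continuous_on UNIV ?u"
    by (rule continuous_on_compose2[OF f(1)]) (auto intro!: continuous_intros)
  moreover have norm: "norm (?u t) = 1" for t using f(2) by force
  ultimately obtain g where g: "continuous_on UNIV g" "\<And>t. ?u t = exp (g t)"
    using continuous_logarithm_on_contractible[of UNIV ?u] convex_imp_contractible[of UNIV]
    by (metis convex_UNIV norm_zero zero_neq_one UNIV_I)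
  have "Re (g t) = 0" for t using norm[of t] unfolding g(2) by simp
  then have "cis (2 * pi * (Im (g t) / (2 * pi))) = ?u t" for t
    unfolding g(2) by (simp add: exp_eq_polar)
  moreover have "continuous_on UNIV (\<lambda>t. Im (g t) / (2 * pi))"
    using g(1) by (intro continuous_intros) auto
  ultimately show ?thesis using that by blast
qed

text \<open>\<open>F t - t\<close> is continuous with integer values.\<close>

lemma continuous_lift_of_identity:
  assumes "continuous_on UNIV F" "\<And>t. cis (2 * pi * F t) = cis (2 * pi * t)"
  obtains c where "\<And>t. F t = t + c"
proof -
  have "(\<lambda>t. F t - t) constant_on UNIV"
  proof (rule continuous_discrete_range_constant)
    show "continuous_on UNIV (\<lambda>t. F t - t)" using assms(1) by (intro continuous_intros)
    have int: "F t - t \<in> \<int>" for t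
    proof -
      obtain j :: int where "2 * pi * F t - 2 * pi * t = of_int j * (2 * pi)"
        using assms(2) unfolding cis_eq_cis_iff by blast
      then have "2 * pi * (F t - t) = 2 * pi * of_int j" by (simp add: algebra_simps)
      then have "F t - t = of_int j" unfolding mult_cancel_left by simp
      then show ?thesis by simp
    qed
    show "\<exists>e>0. \<forall>y. y \<in> UNIV \<and> F y - y \<noteq> F x - x \<longrightarrow> e \<le> norm (F y - y - (F x - x))" for x
    proof (intro exI[of _ 1] conjI allI impI)
      fix y assume ne: "y \<in> UNIV \<and> F y - y \<noteq> F x - x"
      have "F y - y - (F x - x) \<in> \<int>" by (rule Ints_diff[OF int int])
      then show "1 \<le> norm (F y - y - (F x - x))" using ne Ints_nonzero_abs_ge1 by force
    qed simp
  qed simp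
  then obtain c where "F t - t = c" for t by (auto simp: constant_on_def)
  then show ?thesis using that[of c] by (simp add: algebra_simps)
qed

text \<open>Lift both the homeomorphism and its inverse. The two composites of the lifts are lifts of the
  identity, hence translations, so the lift of the homeomorphism is bijective.\<close>

lemma circle_lift_exists:
  assumes h: "homeomorphic_map (top_of_set (sphere (0::complex) 1)) X h" and f: "homeomorphic_map X X f"
  shows "\<exists>F. F \<in> lift (h \<circ> (\<lambda>t. cis (2 * pi * t))) f"
proof -
  let ?S = "top_of_set (sphere (0::complex) 1)"
  obtain h' where h': "homeomorphic_maps ?S X h h'"
    using h homeomorphic_map_maps by blast
  then have "homeomorphic_map X ?S h'"
    by (simp add: homeomorphic_maps_map)
  then have "homeomorphic_map ?S ?S (h' \<circ> (f \<circ> h))"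
    by (rule homeomorphic_map_compose[OF homeomorphic_map_compose[OF h f]])
  then obtain k where k: "homeomorphic_maps ?S ?S (h' \<circ> (f \<circ> h)) k"
    unfolding homeomorphic_map_maps ..
  obtain F where F: "continuous_on UNIV F" "\<And>t. cis (2 * pi * F t) = h' (f (h (cis (2 * pi * t))))"
    using continuous_circle_lift[of "h' \<circ> (f \<circ> h)"] k by (auto simp: homeomorphic_maps_def)
  obtain E where E: "continuous_on UNIV E" "\<And>t. cis (2 * pi * E t) = k (cis (2 * pi * t))"
    using continuous_circle_lift[of k] k by (auto simp: homeomorphic_maps_def)
  have FE: "cis (2 * pi * F (E t)) = cis (2 * pi * t)" for t
    unfolding F E using k by (simp add: homeomorphic_maps_def)
  have EF: "cis (2 * pi * E (F t)) = cis (2 * pi * t)" for t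
    unfolding F E using k by (simp add: homeomorphic_maps_def)
  obtain c where c: "F (E t) = t + c" for t
    using continuous_lift_of_identity[of "F \<circ> E"] FE continuous_on_compose[OF E(1)] F(1)
    by (metis comp_apply continuous_on_subset top_greatest)
  obtain d where d: "E (F t) = t + d" for t
    using continuous_lift_of_identity[of "E \<circ> F"] EF continuous_on_compose[OF F(1)] E(1)
    by (metis comp_apply continuous_on_subset top_greatest)
  have "bij F"
  proof (rule bijI)
    show "inj F" by (rule injI) (metis d add_right_cancel)
    show "surj F" by (rule surjI[of _ "\<lambda>t. E (t - c)"]) (simp add: c)
  qed
  moreover have "(h \<circ> (\<lambda>t. cis (2 * pi * t))) (F t) = f ((h \<circ> (\<lambda>t. cis (2 * pi * t))) t)" for t
  proof -
    have "h (cis (2 * pi * t)) \<in> topspace X"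
      using homeomorphic_imp_surjective_map[OF h] by auto
    then have "f (h (cis (2 * pi * t))) \<in> topspace X"
      using homeomorphic_imp_surjective_map[OF f] by blast
    then show ?thesis using h' by (simp add: F homeomorphic_maps_def)
  qed
  ultimately show ?thesis using F(1) liftI_continuous by blast
qed

text \<open>All that is used of a line or a circle: a description as a quotient of the line together with lifts
  of its homeomorphisms.\<close>

lemma P4_cover:
  assumes "X \<in> P4"
  obtains n p where "line_quotient n (space X) p"
    "\<forall>f. homeomorphic_map (space X) (space X) f \<longrightarrow> (\<exists>F. F \<in> lift p f)"
proof (rule P4_homeomorphism_cases[OF assms])
  fix h assume h: "homeomorphic_map (top_of_set (sphere (0::complex) 1)) (space X) h"
  have "line_quotient 1 (space X) (h \<circ> (\<lambda>t. cis (2 * pi * t)))"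
    using line_quotient_compose_homeomorphic[OF line_quotient_circle h, of 1] by simp
  then show ?thesis using that[of 1] circle_lift_exists[OF h] by simp
next
  fix h assume h: "homeomorphic_map euclideanreal (space X) h"
  show ?thesis using that[of 0, OF line_quotient_homeomorphism[OF h]] line_lift_exists[OF h] by simp
qed

section \<open>The vertices of a CW-complex\<close>

text \<open>Vertices are described as the one-point cells, so that every homeomorphism that permutes
  the cells visibly permutes the vertices, without any appeal to invariance of dimension.\<close>

definition vertices :: "'x cell_structure \<Rightarrow> 'x set"
  where "vertices X = {x. {x} \<in> open_cells X}"

lemma Euclidean_space_top_of_set: "Euclidean_space n = top_of_set {x. \<forall>i\<ge>n. x i = 0}"
  by (simp add: Euclidean_space_def euclidean_product_topology)

text \<open>The closed disc is a closed subset of a product of compact intervals and points.\<close>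

lemma compactin_closed_disc: "compactin (Euclidean_space n) (closed_disc n)"
proof -
  let ?B = "\<Pi>\<^sub>E i\<in>UNIV. if i < n then {-1..1} else {0::real}"
  have "x i \<in> {-1..1}" if "(\<Sum>i<n. x i ^ 2) \<le> 1" "i < n" for i and x :: "nat \<Rightarrow> real"
  proof -
    have "x i ^ 2 \<le> (\<Sum>i<n. x i ^ 2)" using that(2) by (intro member_le_sum) auto
    then have "x i ^ 2 \<le> 1" using that(1) by linarith
    then have "\<bar>x i\<bar> \<le> 1" by (simp add: abs_square_le_1)
    then show ?thesis by auto
  qed
  then have eq: "closed_disc n = {x. (\<Sum>i<n. x i ^ 2) \<le> 1} \<inter> ?B"
    by (fastforce simp: closed_disc_def topspace_Euclidean_space PiE_iff)
  have "compactin (powertop_real UNIV) ?B" by (auto simp: compactin_PiE)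
  then have "compact ?B" by (simp add: euclidean_product_topology)
  moreover have "closed {x :: nat \<Rightarrow> real. (\<Sum>i<n. x i ^ 2) \<le> 1}"
    by (intro closed_Collect_le continuous_intros continuous_on_product_coordinates)
  ultimately have "compact (closed_disc n)" unfolding eq by (intro closed_Int_compact)
  then show ?thesis
    by (auto simp: Euclidean_space_top_of_set compactin_subtopology closed_disc_def topspace_Euclidean_space)
qed

text \<open>The closure of a cell lies in the image of a closed disc, since that image is compact.
  Closure-finiteness then bounds the number of cells that it meets.\<close>

lemma cell_closure_subset_finite_Union:
  assumes "CW_complex X" and e: "e \<in> open_cells X"
  obtains F where "finite F" "F \<subseteq> open_cells X" "space X closure_of e \<subseteq> \<Union>F"
proof -
  obtain n where n: "e \<in> cells X n" using e by (auto simp: open_cells_def)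
  then obtain \<Phi> where \<Phi>: "characteristic_map X n e \<Phi>" and e_sub: "e \<subseteq> topspace (space X)"
    using assms(1) by (fastforce simp: CW_complex_def)
  then obtain F where F: "finite F" "F \<subseteq> (\<Union>m<n. cells X m)" "\<Phi> ` (closed_disc n - open_disc n) \<subseteq> \<Union>F"
    by (auto simp: characteristic_map_def)
  have cont: "continuous_map (subtopology (Euclidean_space n) (closed_disc n)) (space X) \<Phi>"
    and homeo: "homeomorphic_map (subtopology (Euclidean_space n) (open_disc n)) (subtopology (space X) e) \<Phi>"
    using \<Phi> by (auto simp: characteristic_map_def)
  have discs: "open_disc n \<subseteq> closed_disc n" "closed_disc n \<subseteq> topspace (Euclidean_space n)"
    by (auto simp: open_disc_def closed_disc_def)
  have image: "\<Phi> ` open_disc n = e"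
    using homeomorphic_imp_surjective_map[OF homeo] e_sub discs by (simp add: Int_absorb1)
  have "compactin (space X) (\<Phi> ` closed_disc n)"
    by (rule image_compactin[OF _ cont]) (simp add: compactin_subtopology compactin_closed_disc)
  then have "closedin (space X) (\<Phi> ` closed_disc n)"
    using assms(1) compactin_imp_closedin by (auto simp: CW_complex_def)
  then have "space X closure_of e \<subseteq> \<Phi> ` closed_disc n"
    by (rule closure_of_minimal[rotated]) (use image discs in blast)
  also have "\<dots> \<subseteq> \<Union>(insert e F)"
    using F(3) image by blast
  finally show ?thesis
    using that[of "insert e F"] F(1,2) e by (fastforce simp: open_cells_def)
qed

lemma open_cells_disjoint:
  assumes "CW_complex X" "d \<in> open_cells X" "e \<in> open_cells X" "d \<inter> e \<noteq> {}"
  shows "d = e"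
proof -
  have "\<forall>m n. \<forall>d\<in>cells X m. \<forall>e\<in>cells X n. d \<inter> e \<noteq> {} \<longrightarrow> m = n \<and> d = e"
    using assms(1) unfolding CW_complex_def by (elim conjE)
  then show ?thesis using assms(2-) unfolding open_cells_def by blast
qed

lemma vertices_subset: "CW_complex X \<Longrightarrow> vertices X \<subseteq> topspace (space X)"
  by (auto simp: vertices_def CW_complex_def)

text \<open>The closure of a cell meets finitely many cells, and each of them contains at most one vertex.
  So any set of vertices is closed in the weak topology, and the vertices form a closed discrete set.\<close>

lemma closedin_set_of_vertices:
  assumes CW: "CW_complex X" and A: "A \<subseteq> vertices X"
  shows "closedin (space X) A"
proof -
  have "closedin (space X) (A \<inter> (space X closure_of e))" if e: "e \<in> open_cells X" for e
  proof -
    obtain F where F: "finite F" "F \<subseteq> open_cells X" "space X closure_of e \<subseteq> \<Union>F"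
      by (rule cell_closure_subset_finite_Union[OF CW e])
    have "finite (A \<inter> d)" if "d \<in> F" for d
    proof (rule finite_subset[of _ "{THE x. d = {x}}"])
      show "A \<inter> d \<subseteq> {THE x. d = {x}}"
      proof
        fix x assume x: "x \<in> A \<inter> d"
        then have "{x} \<in> open_cells X" "{x} \<inter> d \<noteq> {}"
          using A by (auto simp: vertices_def)
        then have "{x} = d" using open_cells_disjoint[OF CW] F(2) that by blast
        then show "x \<in> {THE x. d = {x}}" by auto
      qed
    qed simp
    then have "finite (\<Union>d\<in>F. A \<inter> d)" using F(1) by blast
    then have "finite (A \<inter> \<Union>F)" by (simp only: Int_Union)
    then have fin: "finite (A \<inter> (space X closure_of e))"
      by (rule finite_subset[rotated]) (use F(3) in blast)
    have "A \<inter> (space X closure_of e) \<subseteq> topspace (space X)"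
      using A vertices_subset[OF CW] by blast
    then show ?thesis
      using fin CW by (meson CW_complex_def Hausdorff_imp_t1_space t1_space_closedin_finite)
  qed
  moreover have "A \<subseteq> topspace (space X)" using A vertices_subset[OF CW] by blast
  moreover have "\<forall>A\<subseteq>topspace (space X). closedin (space X) A \<longleftrightarrow>
      (\<forall>e\<in>open_cells X. closedin (space X) (A \<inter> (space X closure_of e)))"
    using CW unfolding CW_complex_def by (elim conjE)
  ultimately show ?thesis by simp
qed

text \<open>A cell of least dimension is a point: the boundary of a disc of positive dimension is nonempty and
  would have to be mapped into cells of smaller dimension.\<close>

lemma vertices_nonempty:
  assumes CW: "CW_complex X" and ne: "topspace (space X) \<noteq> {}"
  shows "vertices X \<noteq> {}"
proof -
  have "\<Union>(open_cells X) = topspace (space X)" using CW unfolding CW_complex_def by (elim conjE)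
  then have "\<exists>n. cells X n \<noteq> {}" using ne unfolding open_cells_def by blast
  define n where "n = (LEAST n. cells X n \<noteq> {})"
  have "cells X n \<noteq> {}" unfolding n_def by (rule LeastI_ex[OF \<open>\<exists>n. cells X n \<noteq> {}\<close>])
  then obtain e where e: "e \<in> cells X n" by blast
  then obtain \<Phi> where \<Phi>: "characteristic_map X n e \<Phi>" and e_sub: "e \<subseteq> topspace (space X)"
    using CW by (fastforce simp: CW_complex_def)
  have "n = 0"
  proof (rule ccontr)
    assume "n \<noteq> 0"
    \<comment> \<open>a point of the boundary sphere of the disc\<close>
    define x :: "nat \<Rightarrow> real" where "x = (\<lambda>i. if i = 0 then 1 else 0)"
    have "(\<Sum>i<n. x i ^ 2) = 1"
      using \<open>n \<noteq> 0\<close> by (simp add: x_def if_distrib[of "\<lambda>x. x ^ 2"] sum.delta cong: if_cong)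
    then have "x \<in> closed_disc n - open_disc n"
      using \<open>n \<noteq> 0\<close> by (simp add: closed_disc_def open_disc_def topspace_Euclidean_space) (simp add: x_def)
    then obtain d m where "d \<in> cells X m" "m < n"
      using \<Phi> unfolding characteristic_map_def by blast
    then show False using not_less_Least[of m "\<lambda>n. cells X n \<noteq> {}"] by (auto simp: n_def)
  qed
  then have "homeomorphic_map (subtopology (Euclidean_space 0) (open_disc 0)) (subtopology (space X) e) \<Phi>"
    using \<Phi> by (simp add: characteristic_map_def)
  from homeomorphic_imp_surjective_map[OF this]
  have "e = \<Phi> ` (topspace (Euclidean_space 0) \<inter> open_disc 0)"
    using e_sub by (simp add: Int_absorb1)
  moreover have "topspace (Euclidean_space 0) \<inter> open_disc 0 = {\<lambda>_. 0}"
    by (auto simp: topspace_Euclidean_space open_disc_def)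
  ultimately have "e = {\<Phi> (\<lambda>_. 0)}" by simp
  then show ?thesis using e by (auto simp: vertices_def open_cells_def)
qed

text \<open>Two points of a fibre differ by an integer, whatever \<open>n\<close> is.\<close>

lemma line_quotient_fibre_finite:
  assumes "line_quotient n X p"
  shows "finite ({a..b} \<inter> {t. p t = y})"
proof (cases "\<exists>s. p s = y")
  case True
  then obtain s where s: "p s = y" by blast
  have "{a..b} \<inter> {t. p t = y} \<subseteq> (\<lambda>k::int. s + of_int k) ` {\<lfloor>a - s\<rfloor>..\<lceil>b - s\<rceil>}"
  proof
    fix t assume t: "t \<in> {a..b} \<inter> {t. p t = y}"
    then have "p t = p s" using s by simp
    then obtain j :: int where "t - s = of_int j * real n"
      using assms unfolding line_quotient_def by blast
    then have k: "t = s + of_int (j * int n)" by simp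
    have "j * int n \<in> {\<lfloor>a - s\<rfloor>..\<lceil>b - s\<rceil>}"
    proof -
      have "a - s \<le> of_int (j * int n)" "of_int (j * int n) \<le> b - s" using t k by auto
      then show ?thesis by (simp only: atLeastAtMost_iff) linarith
    qed
    then show "t \<in> (\<lambda>k::int. s + of_int k) ` {\<lfloor>a - s\<rfloor>..\<lceil>b - s\<rceil>}" using k by blast
  qed
  then show ?thesis by (rule finite_subset) simp
next
  case False
  then have "{a..b} \<inter> {t. p t = y} = {}" by auto
  then show ?thesis by simp
qed

text \<open>The vertices in the compact image of \<open>{a..b}\<close> form a compact discrete set, which is finite, and
  each has finitely many preimages in \<open>{a..b}\<close>.\<close>

lemma vertices_locally_finite:
  assumes CW: "CW_complex X" and p: "line_quotient n (space X) p"
  shows "finite (p -` vertices X \<inter> {a..b})"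
proof -
  let ?S = "vertices X \<inter> p ` {a..b}"
  have q: "quotient_map euclideanreal (space X) p" using p by (simp add: line_quotient_def)
  have "compactin (space X) (p ` {a..b})"
    by (rule image_compactin[OF _ quotient_imp_continuous_map[OF q]]) simp
  then have "compactin (space X) ?S"
    by (rule closed_Int_compactin[OF closedin_set_of_vertices[OF CW order_refl]])
  moreover have "?S \<inter> space X derived_set_of ?S = {}"
  proof -
    have "x \<notin> space X derived_set_of ?S" if x: "x \<in> ?S" for x
    proof
      assume d: "x \<in> space X derived_set_of ?S"
      have "openin (space X) (topspace (space X) - (?S - {x}))"
        by (intro openin_diff openin_topspace closedin_set_of_vertices[OF CW]) auto
      moreover have "x \<in> topspace (space X) - (?S - {x})"
        using x vertices_subset[OF CW] by auto
      moreover have "\<forall>T. x \<in> T \<and> openin (space X) T \<longrightarrow> (\<exists>y. y \<noteq> x \<and> y \<in> ?S \<and> y \<in> T)"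
        using d unfolding in_derived_set_of by (elim conjE)
      ultimately have "\<exists>y. y \<noteq> x \<and> y \<in> ?S \<and> y \<in> topspace (space X) - (?S - {x})"
        by (simp only: simp_thms)
      then show False by blast
    qed
    then show ?thesis by blast
  qed
  ultimately have fin: "finite ?S" using discrete_compactin_eq_finite by blast
  have "p -` vertices X \<inter> {a..b} \<subseteq> (\<Union>y\<in>?S. {a..b} \<inter> {t. p t = y})" by auto
  then show ?thesis
    by (rule finite_subset) (intro finite_UN_I fin line_quotient_fibre_finite[OF p])
qed

section \<open>Groups acting on a line or circle\<close>

lemma lift_compose:
  assumes E: "E \<in> lift p f" and F: "F \<in> lift p g" and h: "\<And>t. h (p t) = f (g (p t))"
  shows "E \<circ> F \<in> lift p h"
proof -
  have "strict_mono (E \<circ> F) \<or> strict_antimono_on UNIV (E \<circ> F)"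
    using E F by (auto simp: lift_def monotone_on_def)
  then show ?thesis using E F h by (auto simp: lift_def intro: bij_comp)
qed

lemma lift_inverse:
  assumes F: "F \<in> lift p f" and g: "\<And>t. g (f (p t)) = p t"
  shows "inv_into UNIV F \<in> lift p g"
proof -
  let ?E = "inv_into UNIV F"
  have bij: "bij F" using F by (simp add: lift_def)
  have FE: "F (?E t) = t" for t using bij by (simp add: bij_is_surj surj_f_inv_f)
  have "strict_mono ?E \<or> strict_antimono_on UNIV ?E"
  proof (cases "strict_mono F")
    case True
    have "?E s < ?E t" if "s < t" for s t
      using that strict_mono_less[OF True, of "?E s" "?E t"] by (simp add: FE)
    then show ?thesis by (simp add: strict_mono_def)
  next
    case False
    then have anti: "strict_antimono_on UNIV F" using F by (simp add: lift_def)
    have "?E t < ?E s" if "s < t" for s t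
      using that monotone_onD[OF anti, of "?E s" "?E t"]
      by (cases "?E s" "?E t" rule: linorder_cases) (use FE[of s] FE[of t] in auto)
    then show ?thesis by (simp add: monotone_on_def)
  qed
  moreover have "p (?E t) = g (p t)" for t
    using F g[of "?E t"] FE[of t] by (simp add: lift_def) metis
  ultimately show ?thesis using bij by (simp add: lift_def bij_imp_bij_inv)
qed

text \<open>Applied to the lifts of the action and a vertex \<open>p v\<close>: the fixer of \<open>v\<close> is a subgroup of the
  isotropy group of \<open>p v\<close>, hence polycyclic.\<close>

lemma polycyclic_if_isotropy_polycyclic:
  fixes G (structure)
  assumes "group G" and X: "X \<in> P4" and act: "cellular_action G X \<phi>"
    and iso: "\<And>x. x \<in> topspace (space X) \<Longrightarrow> polycyclic_group (G\<lparr>carrier := stabilizer G \<phi> x\<rparr>)"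
  shows "polycyclic_group G"
proof -
  interpret group G by fact
  interpret group_action G "topspace (space X)" \<phi> using act by (simp add: cellular_action_def)
  obtain n p where p: "line_quotient n (space X) p" and
    lifts: "\<forall>f. homeomorphic_map (space X) (space X) f \<longrightarrow> (\<exists>F. F \<in> lift p f)"
    by (rule P4_cover[OF X])
  have CW: "CW_complex X" using X by (simp add: P4_def)
  have q: "quotient_map euclideanreal (space X) p" using p by (simp add: line_quotient_def)
  have p_top: "p t \<in> topspace (space X)" for t using quotient_imp_surjective_map[OF q] by auto
  have inverse: "\<phi> (inv g) (\<phi> g (p t)) = p t" if "g \<in> carrier G" for g t
    using orbit_sym_aux[OF that p_top] by blast
  have V: "\<phi> g x \<in> vertices X" if "g \<in> carrier G" "x \<in> vertices X" for g x
  proof -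
    have "bij_betw (\<lambda>e. \<phi> g ` e) (open_cells X) (open_cells X)"
      using act that(1) unfolding cellular_action_def by simp
    then have "\<phi> g ` {x} \<in> open_cells X"
      using that(2) bij_betwE unfolding vertices_def by blast
    then show ?thesis by (simp add: vertices_def)
  qed
  interpret monotone_lifting G "\<lambda>g. lift p (\<phi> g)" "p -` vertices X"
  proof
    show "\<exists>F. F \<in> lift p (\<phi> g)" if "g \<in> carrier G" for g
      using that act lifts by (simp add: cellular_action_def)
    show "id \<in> lift p (\<phi> \<one>)"
      using p_top by (simp add: lift_def strict_mono_def flip: id_eq_one)
    show "E \<circ> F \<in> lift p (\<phi> (g \<otimes> h))"
      if "g \<in> carrier G" "h \<in> carrier G" "E \<in> lift p (\<phi> g)" "F \<in> lift p (\<phi> h)" for g h E F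
      using lift_compose[OF that(3,4)] composition_rule[OF p_top that(1,2)] by blast
    show "inv_into UNIV F \<in> lift p (\<phi> (inv g))" if "g \<in> carrier G" "F \<in> lift p (\<phi> g)" for g F
      using lift_inverse[OF that(2)] inverse[OF that(1)] by blast
    show "F t \<in> p -` vertices X \<longleftrightarrow> t \<in> p -` vertices X"
      if "g \<in> carrier G" "F \<in> lift p (\<phi> g)" for g F t
    proof -
      have "p (F t) = \<phi> g (p t)" using that(2) by (simp add: lift_def)
      then show ?thesis
        using V[OF that(1), of "p t"] V[OF inv_closed[OF that(1)], of "\<phi> g (p t)"]
          inverse[OF that(1), of t] by auto
    qed
    show "finite (p -` vertices X \<inter> {a..b})" for a b
      by (rule vertices_locally_finite[OF CW p])
  qed (auto simp: lift_def)
  have "topspace (space X) \<noteq> {}" using p_top by blast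
  then obtain x where x: "x \<in> vertices X" using vertices_nonempty[OF CW] by blast
  then have "x \<in> p ` topspace euclideanreal"
    using vertices_subset[OF CW] unfolding quotient_imp_surjective_map[OF q] by blast
  then obtain v where v: "p v = x" by blast
  let ?S = "stabilizer G \<phi> (p v)"
  have "polycyclic_seq (G\<lparr>carrier := ?S\<rparr>) ?S"
    using iso[OF p_top] by (simp add: polycyclic_group_def)
  then have "polycyclic_seq G ?S"
    by (rule polycyclic_seq_restrict[OF stabilizer_subgroup[OF p_top]])
  moreover have "fixer v \<subseteq> ?S"
  proof
    fix g assume "g \<in> fixer v"
    then obtain F where F: "g \<in> carrier G" "F \<in> lift p (\<phi> g)" "F v = v"
      by (auto simp: fixer_def increasing_lift_def)
    have "p (F v) = \<phi> g (p v)" using F(2) by (simp add: lift_def)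
    then show "g \<in> ?S" using F by (simp add: stabilizer_def)
  qed
  ultimately have "polycyclic_seq G (fixer v)"
    using polycyclic_seq_subgroup subgroup_fixer by blast
  then show ?thesis
    using polycyclic_if_fixer_polycyclic[of v] x v group_axioms by (simp add: polycyclic_group_def)
qed

lemma Ncell_P4_imp_polycyclic: "Ncell P4 G \<Longrightarrow> polycyclic_group G"
proof (induction rule: Ncell.induct)
  case (trivial G)
  then show ?case
    using polycyclic_seq.unity[of G] by (simp add: trivial_group_def polycyclic_group_def)
next
  case (action G X \<phi>)
  then show ?case using polycyclic_if_isotropy_polycyclic by blast
qed

section \<open>Cell structures on quotients of the line\<close>

text \<open>The images of the integers are the vertices and the images of the unit intervals between them
  are the edges. On a circle of length \<open>n\<close> the same cell arises from \<open>k\<close> and \<open>k + n\<close>; for \<open>n = 1\<close>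
  there is one vertex and one edge.\<close>

definition unit_cells :: "'x topology \<Rightarrow> (real \<Rightarrow> 'x) \<Rightarrow> 'x cell_structure"
  where "unit_cells S p = \<lparr>space = S,
    cells = (\<lambda>d. if d = 0 then range (\<lambda>k::int. {p (of_int k)})
      else if d = 1 then range (\<lambda>k::int. p ` {of_int k<..<of_int k + 1}) else {})\<rparr>"

lemma open_cells_unit_cells:
  "open_cells (unit_cells S p) =
    range (\<lambda>k::int. {p (of_int k)}) \<union> range (\<lambda>k::int. p ` {of_int k<..<of_int k + 1})"
  by (auto simp: open_cells_def unit_cells_def split: if_splits)

lemma line_quotient_eqD:
  assumes "line_quotient n S p" "p s = p t" "\<bar>s - t\<bar> < 1"
  shows "s = t"
proof -
  obtain j :: int where "s - t = of_int j * real n"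
    using assms by (auto simp: line_quotient_def)
  then have j: "s - t = of_int (j * int n)" by simp
  then have "\<bar>j * int n\<bar> < 1" using assms(3) by linarith
  then have eq: "j * int n = 0" by linarith
  show ?thesis using j unfolding eq by simp
qed

text \<open>The saturation of \<open>U\<close> is a union of translates of \<open>U\<close>.\<close>

lemma line_quotient_open_image:
  assumes p: "line_quotient n S p" and U: "open U"
  shows "openin S (p ` U)"
proof -
  have q: "quotient_map euclideanreal S p" using p by (simp add: line_quotient_def)
  have eq: "{x \<in> topspace euclideanreal. p x \<in> p ` U} = (\<Union>j::int. (\<lambda>t. of_int j * real n + t) ` U)"
  proof (intro equalityI subsetI)
    fix x assume "x \<in> {x \<in> topspace euclideanreal. p x \<in> p ` U}"
    then obtain t where t: "t \<in> U" "p x = p t" by auto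
    then obtain j :: int where "x - t = of_int j * real n" using p by (auto simp: line_quotient_def)
    then have "x = of_int j * real n + t" by simp
    then show "x \<in> (\<Union>j::int. (\<lambda>t. of_int j * real n + t) ` U)" using t by blast
  next
    fix x assume "x \<in> (\<Union>j::int. (\<lambda>t. of_int j * real n + t) ` U)"
    then obtain t and j :: int where t: "t \<in> U" "x = of_int j * real n + t" by blast
    then have "x - t = of_int j * real n" by simp
    then have "p x = p t" using p unfolding line_quotient_def by blast
    then show "x \<in> {x \<in> topspace euclideanreal. p x \<in> p ` U}" using t by simp
  qed
  have "open (\<Union>j::int. (\<lambda>t. of_int j * real n + t) ` U)"
    using U by (intro open_UN ballI open_translation)
  then have "openin euclideanreal {x \<in> topspace euclideanreal. p x \<in> p ` U}" unfolding eq by simp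
  moreover have "p ` U \<subseteq> topspace S" using quotient_imp_surjective_map[OF q] by auto
  ultimately show ?thesis using q unfolding quotient_map_def by blast
qed

lemma line_quotient_homeomorphic_on_unit_interval:
  fixes a :: real
  assumes p: "line_quotient n S p"
  shows "homeomorphic_map (top_of_set {a<..<a + 1}) (subtopology S (p ` {a<..<a + 1})) p"
proof (rule bijective_open_imp_homeomorphic_map)
  let ?I = "{a<..<a + 1}"
  have q: "quotient_map euclideanreal S p" using p by (simp add: line_quotient_def)
  have top: "p ` ?I \<subseteq> topspace S" using quotient_imp_surjective_map[OF q] by auto
  show "continuous_map (top_of_set ?I) (subtopology S (p ` ?I)) p"
    using continuous_map_from_subtopology[OF quotient_imp_continuous_map[OF q]]
    by (auto simp: continuous_map_in_subtopology)
  show "open_map (top_of_set ?I) (subtopology S (p ` ?I)) p"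
    unfolding open_map_def
  proof (intro allI impI)
    fix U assume U: "openin (top_of_set ?I) U"
    then have "open U" by (simp add: openin_open_eq)
    moreover have "U \<subseteq> ?I" using openin_subset[OF U] by simp
    ultimately show "openin (subtopology S (p ` ?I)) (p ` U)"
      using line_quotient_open_image[OF p]
      by (simp add: openin_open_subtopology image_mono)
  qed
  show "p ` topspace (top_of_set ?I) = topspace (subtopology S (p ` ?I))"
    using top by (simp add: Int_absorb1)
  show "inj_on p (topspace (top_of_set ?I))"
    by (rule inj_onI) (auto intro!: line_quotient_eqD[OF p])
qed

lemma characteristic_map_0_cell:
  assumes "x \<in> topspace (space X)"
  shows "characteristic_map X 0 {x} (\<lambda>_. x)"
proof -
  have disc: "open_disc 0 = {\<lambda>_. 0}" "closed_disc 0 = {\<lambda>_. 0}"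
    by (auto simp: open_disc_def closed_disc_def topspace_Euclidean_space)
  have "homeomorphic_maps (subtopology (Euclidean_space 0) {\<lambda>_. 0}) (subtopology (space X) {x})
      (\<lambda>_. x) (\<lambda>_ _. 0)"
    using assms by (auto simp: homeomorphic_maps_def continuous_map_in_subtopology topspace_Euclidean_space)
  then show ?thesis
    using assms unfolding characteristic_map_def disc homeomorphic_map_maps by auto
qed

text \<open>The affine parametrisation of \<open>{a<..<a + 1}\<close> by the open disc of dimension one.\<close>

lemma Euclidean_space_1_coordinate:
  fixes a :: real
  shows "continuous_map (Euclidean_space 1) euclideanreal (\<lambda>x. a + (x 0 + 1) / 2)"
    "homeomorphic_map (subtopology (Euclidean_space 1) (open_disc 1)) (top_of_set {a<..<a + 1})
      (\<lambda>x. a + (x 0 + 1) / 2)"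
proof -
  note E = Euclidean_space_top_of_set[of 1]
  show cont: "continuous_map (Euclidean_space 1) euclideanreal (\<lambda>x. a + (x 0 + 1) / 2)"
    unfolding E
    by (auto intro!: continuous_intros continuous_on_subset[OF continuous_on_product_coordinates])
  let ?f = "\<lambda>x::nat \<Rightarrow> real. a + (x 0 + 1) / 2"
  let ?g = "\<lambda>r i. if i = (0::nat) then 2 * (r - a) - 1 else (0::real)"
  have range: "x \<in> open_disc 1 \<longleftrightarrow> (\<forall>i\<ge>1. x i = 0) \<and> \<bar>x 0\<bar> < 1" for x
    by (auto simp: open_disc_def topspace_Euclidean_space abs_square_less_1)
  have "homeomorphic_maps (subtopology (Euclidean_space 1) (open_disc 1)) (top_of_set {a<..<a + 1}) ?f ?g"
    unfolding homeomorphic_maps_def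
  proof (intro conjI ballI)
    show "continuous_map (subtopology (Euclidean_space 1) (open_disc 1)) (top_of_set {a<..<a + 1}) ?f"
      using continuous_map_from_subtopology[OF cont]
      by (auto simp: continuous_map_in_subtopology range field_simps simp del: One_nat_def)
    have "continuous_on {a<..<a + 1} (\<lambda>r. ?g r i)" for i
      by (cases "i = 0") (auto intro!: continuous_intros)
    then have "continuous_on {a<..<a + 1} ?g"
      by (rule continuous_on_coordinatewise_then_product)
    then show "continuous_map (top_of_set {a<..<a + 1}) (subtopology (Euclidean_space 1) (open_disc 1)) ?g"
      unfolding E by (auto simp: continuous_map_in_subtopology range simp del: One_nat_def)
    show "?g (?f x) = x" if "x \<in> topspace (subtopology (Euclidean_space 1) (open_disc 1))" for x
      using that by (auto simp: range fun_eq_iff field_simps simp del: One_nat_def)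
    show "?f (?g y) = y" for y by (simp add: field_simps)
  qed
  then show "homeomorphic_map (subtopology (Euclidean_space 1) (open_disc 1)) (top_of_set {a<..<a + 1}) ?f"
    using homeomorphic_map_maps by blast
qed

lemma characteristic_map_unit_cell:
  fixes k :: int
  assumes p: "line_quotient n S p"
  shows "characteristic_map (unit_cells S p) 1 (p ` {of_int k<..<of_int k + 1})
    (\<lambda>x. p (of_int k + (x 0 + 1) / 2))"
proof -
  let ?f = "\<lambda>x::nat \<Rightarrow> real. of_int k + (x 0 + 1) / 2"
  have q: "quotient_map euclideanreal S p" using p by (simp add: line_quotient_def)
  have "continuous_map (subtopology (Euclidean_space 1) (closed_disc 1)) S (p \<circ> ?f)"
    by (rule continuous_map_compose[OF
          continuous_map_from_subtopology[OF Euclidean_space_1_coordinate(1)] quotient_imp_continuous_map[OF q]])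
  moreover have "homeomorphic_map (subtopology (Euclidean_space 1) (open_disc 1))
      (subtopology S (p ` {of_int k<..<of_int k + 1})) (p \<circ> ?f)"
    by (rule homeomorphic_map_compose[OF
          Euclidean_space_1_coordinate(2) line_quotient_homeomorphic_on_unit_interval[OF p]])
  moreover have "(p \<circ> ?f) ` (closed_disc 1 - open_disc 1) \<subseteq> \<Union>{{p (of_int k)}, {p (of_int (k + 1))}}"
  proof
    fix y assume "y \<in> (p \<circ> ?f) ` (closed_disc 1 - open_disc 1)"
    then obtain x where x: "x \<in> closed_disc 1 - open_disc 1" "y = p (?f x)" by auto
    then have "x 0 ^ 2 = 1" by (auto simp: closed_disc_def open_disc_def)
    then have "x 0 = 1 \<or> x 0 = - 1" by (simp add: power2_eq_1_iff)
    then show "y \<in> \<Union>{{p (of_int k)}, {p (of_int (k + 1))}}" using x(2) by auto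
  qed
  moreover have "{{p (of_int k)}, {p (of_int (k + 1))}} \<subseteq> (\<Union>m<1. cells (unit_cells S p) m)"
  proof -
    have "{{p (of_int k)}, {p (of_int (k + 1))}} \<subseteq> range (\<lambda>k::int. {p (of_int k)})" by blast
    also have "\<dots> = (\<Union>m<1. cells (unit_cells S p) m)" by (auto simp: unit_cells_def)
    finally show ?thesis .
  qed
  ultimately show ?thesis
    unfolding characteristic_map_def
    by (intro conjI exI[of _ "{{p (of_int k)}, {p (of_int (k + 1))}}"])
      (simp_all add: unit_cells_def comp_def)
qed

text \<open>The unit intervals between integers form a locally finite closed cover.\<close>

lemma closed_if_unit_intervals_closed:
  fixes A :: "real set"
  assumes "\<And>k::int. closed (A \<inter> {of_int k..of_int k + 1})"
  shows "closed A"
proof -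
  let ?C = "range (\<lambda>k::int. A \<inter> {of_int k..of_int k + 1})"
  have "locally_finite_in euclideanreal ?C"
    unfolding locally_finite_in_def
  proof (intro conjI ballI)
    fix x :: real assume "x \<in> topspace euclideanreal"
    have "{U \<in> ?C. U \<inter> {x - 1<..<x + 1} \<noteq> {}}
        \<subseteq> (\<lambda>k::int. A \<inter> {of_int k..of_int k + 1}) ` {\<lfloor>x\<rfloor> - 2..\<lfloor>x\<rfloor> + 2}"
    proof
      fix U assume U: "U \<in> {U \<in> ?C. U \<inter> {x - 1<..<x + 1} \<noteq> {}}"
      then obtain k :: int and y where k: "U = A \<inter> {of_int k..of_int k + 1}" "y \<in> U" "y \<in> {x - 1<..<x + 1}"
        by blast
      then have "k \<in> {\<lfloor>x\<rfloor> - 2..\<lfloor>x\<rfloor> + 2}" by auto linarith+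
      then show "U \<in> (\<lambda>k::int. A \<inter> {of_int k..of_int k + 1}) ` {\<lfloor>x\<rfloor> - 2..\<lfloor>x\<rfloor> + 2}"
        using k(1) by blast
    qed
    then have "finite {U \<in> ?C. U \<inter> {x - 1<..<x + 1} \<noteq> {}}" by (rule finite_subset) simp
    then show "\<exists>V. openin euclideanreal V \<and> x \<in> V \<and> finite {U \<in> ?C. U \<inter> V \<noteq> {}}"
      by (intro exI[of _ "{x - 1<..<x + 1}"]) simp
  qed simp
  then have "closedin euclideanreal (\<Union>?C)"
    using assms by (intro closedin_locally_finite_Union) auto
  moreover have "\<Union>?C = A"
  proof -
    have "x \<in> {of_int \<lfloor>x\<rfloor>..of_int \<lfloor>x\<rfloor> + 1}" for x :: real by simp
    then show ?thesis by blast
  qed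
  ultimately show ?thesis by simp
qed

text \<open>For the weak topology, a set meeting every closed edge in a closed set has a preimage meeting
  every \<open>{k..k + 1}\<close> in a closed set. That preimage is closed, and so is the set, by the quotient
  topology. Disjointness of the cells holds because \<open>p\<close> identifies points differing by integers only,
  so it respects fractional parts.\<close>

lemma CW_complex_unit_cells:
  assumes p: "line_quotient n S p" and H: "Hausdorff_space S"
  shows "CW_complex (unit_cells S p)"
proof -
  let ?X = "unit_cells S p" and ?I = "\<lambda>k::int. {real_of_int k<..<of_int k + 1}"
  have q: "quotient_map euclideanreal S p" using p by (simp add: line_quotient_def)
  have top: "topspace S = range p" using quotient_imp_surjective_map[OF q] by simp
  have space: "space ?X = S" by (simp add: unit_cells_def)
  have cells: "cells ?X d = (if d = 0 then range (\<lambda>k::int. {p (of_int k)})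
      else if d = 1 then range (\<lambda>k. p ` ?I k) else {})" for d
    by (simp add: unit_cells_def)
  have "\<Union>(open_cells ?X) = topspace S"
  proof -
    have "\<exists>e\<in>open_cells ?X. p t \<in> e" for t
    proof (cases "t = of_int \<lfloor>t\<rfloor>")
      case True
      then have "p t \<in> {p (of_int \<lfloor>t\<rfloor>)}" by simp
      then show ?thesis unfolding open_cells_unit_cells by blast
    next
      case False
      then have "t \<in> ?I \<lfloor>t\<rfloor>" by simp linarith
      then have "p t \<in> p ` ?I \<lfloor>t\<rfloor>" by (rule imageI)
      then show ?thesis unfolding open_cells_unit_cells by blast
    qed
    moreover have "\<Union>(open_cells ?X) \<subseteq> range p" unfolding open_cells_unit_cells by blast
    ultimately show ?thesis unfolding top by blast
  qed
  moreover have disjoint: "a = b \<and> d = e"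
    if d: "d \<in> cells ?X a" and e: "e \<in> cells ?X b" and ne: "d \<inter> e \<noteq> {}" for a b d e
  proof -
    have mixed: False if "p (of_int k) = p s" "s \<in> ?I l" for k l :: int and s
    proof -
      obtain j :: int where "of_int k - s = of_int j * real n"
        using p \<open>p (of_int k) = p s\<close> unfolding line_quotient_def by blast
      then have "s = of_int (k - j * int n)" by simp
      then obtain i :: int where "s = of_int i" ..
      then have "l < i" "i < l + 1" using that(2) by auto
      then show False by linarith
    qed
    have same: "p ` ?I k \<subseteq> p ` ?I l" if "p s = p t" "s \<in> ?I k" "t \<in> ?I l" for k l :: int and s t
    proof
      obtain j :: int where "s - t = of_int j * real n"
        using p \<open>p s = p t\<close> unfolding line_quotient_def by blast
      then have st: "s = t + of_int (j * int n)" by simp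
      have "k = l + i" if "s = t + of_int i" for i
      proof -
        have "real_of_int k < of_int (l + i + 1)" "of_int (l + i) < real_of_int (k + 1)"
          using that \<open>s \<in> ?I k\<close> \<open>t \<in> ?I l\<close> by auto
        then show ?thesis unfolding of_int_less_iff by linarith
      qed
      then have kl: "k = l + j * int n" using st by blast
      fix y assume "y \<in> p ` ?I k"
      then obtain r where r: "r \<in> ?I k" "y = p r" by blast
      have "r - (r - of_int (j * int n)) = of_int j * real n" by simp
      then have "p r = p (r - of_int (j * int n))" using p unfolding line_quotient_def by blast
      moreover have "r - of_int (j * int n) \<in> ?I l" using r(1) unfolding kl by simp
      ultimately show "y \<in> p ` ?I l" using r(2) by blast
    qed
    obtain x where x: "x \<in> d" "x \<in> e" using ne by blast
    consider k l where "a = 0" "b = 0" "d = {p (of_int k)}" "e = {p (of_int l)}"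
      | k l where "a = 0" "b = 1" "d = {p (of_int k)}" "e = p ` ?I l"
      | k l where "a = 1" "b = 0" "d = p ` ?I k" "e = {p (of_int l)}"
      | k l where "a = 1" "b = 1" "d = p ` ?I k" "e = p ` ?I l"
      using d e unfolding cells by (auto split: if_splits)
    then show ?thesis
    proof cases
      case 1
      then show ?thesis using x by auto
    next
      case (2 k l)
      then obtain s where "s \<in> ?I l" "p (of_int k) = p s" using x by auto
      then show ?thesis using mixed by blast
    next
      case (3 k l)
      then obtain s where "s \<in> ?I k" "p (of_int l) = p s" using x by auto
      then show ?thesis using mixed by blast
    next
      case (4 k l)
      then obtain s t where "s \<in> ?I k" "t \<in> ?I l" "p s = p t" using x by auto
      then show ?thesis using 4 same[of s t k l] same[of t s l k] by auto
    qed
  qed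
  moreover have "e \<subseteq> topspace S \<and> (\<exists>\<Phi>. characteristic_map ?X d e \<Phi>)" if e: "e \<in> cells ?X d" for d e
  proof -
    consider k where "d = 0" "e = {p (of_int k)}" | k where "d = 1" "e = p ` ?I k"
      using e unfolding cells by (auto split: if_splits)
    then show ?thesis
    proof cases
      case (1 k)
      have "p (of_int k) \<in> topspace (space ?X)" by (simp add: space top)
      then have "characteristic_map ?X 0 {p (of_int k)} (\<lambda>_. p (of_int k))"
        by (rule characteristic_map_0_cell)
      then show ?thesis using 1 by (auto simp: top)
    next
      case (2 k)
      then show ?thesis using characteristic_map_unit_cell[OF p] by (auto simp: top)
    qed
  qed
  moreover have "closedin S A \<longleftrightarrow> (\<forall>e\<in>open_cells ?X. closedin S (A \<inter> (S closure_of e)))"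
    if A: "A \<subseteq> topspace S" for A
  proof
    assume "closedin S A"
    then show "\<forall>e\<in>open_cells ?X. closedin S (A \<inter> (S closure_of e))"
      by (intro ballI closedin_Int closedin_closure_of)
  next
    assume weak: "\<forall>e\<in>open_cells ?X. closedin S (A \<inter> (S closure_of e))"
    have "closed ({t. p t \<in> A} \<inter> {of_int k..of_int k + 1})" for k :: int
    proof -
      let ?e = "p ` ?I k"
      have "p ` (euclideanreal closure_of ?I k) \<subseteq> S closure_of ?e"
        by (rule continuous_map_image_closure_subset[OF quotient_imp_continuous_map[OF q]])
      then have cl: "p t \<in> S closure_of ?e" if "t \<in> {of_int k..of_int k + 1}" for t
        using that by auto
      have "?e \<in> open_cells ?X" unfolding open_cells_unit_cells by blast
      then have "closedin S (A \<inter> (S closure_of ?e))" using weak by blast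
      then have "closedin euclideanreal {t \<in> topspace euclideanreal. p t \<in> A \<inter> (S closure_of ?e)}"
        by (rule closedin_continuous_map_preimage[OF quotient_imp_continuous_map[OF q]])
      then have "closed ({t. p t \<in> A \<inter> (S closure_of ?e)} \<inter> {of_int k..of_int k + 1})"
        by (intro closed_Int) auto
      moreover have "{t. p t \<in> A \<inter> (S closure_of ?e)} \<inter> {of_int k..of_int k + 1}
          = {t. p t \<in> A} \<inter> {of_int k..of_int k + 1}"
        using cl by blast
      ultimately show ?thesis by simp
    qed
    then have "closed {t. p t \<in> A}" by (rule closed_if_unit_intervals_closed)
    then show "closedin S A" using q A unfolding quotient_map_closedin by simp
  qed
  ultimately show ?thesis unfolding CW_complex_def space using H by simp
qed

section \<open>Translations\<close>

text \<open>The restriction makes the map extensional, as membership in the group of bijections of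
  \<open>topspace S\<close> demands.\<close>

definition translation :: "'x topology \<Rightarrow> (real \<Rightarrow> 'x) \<Rightarrow> int \<Rightarrow> 'x \<Rightarrow> 'x"
  where "translation S p m = restrict (\<lambda>z. p (inv_into UNIV p z + of_int m)) (topspace S)"

lemma translation_apply:
  assumes p: "line_quotient n S p"
  shows "translation S p m (p t) = p (t + of_int m)"
proof -
  have "p t \<in> topspace S"
    using p quotient_imp_surjective_map[of euclideanreal S p] by (auto simp: line_quotient_def)
  moreover have "p (inv_into UNIV p (p t)) = p t" by (rule f_inv_into_f) simp
  then obtain j :: int where "inv_into UNIV p (p t) - t = of_int j * real n"
    using p unfolding line_quotient_def by blast
  then have "(inv_into UNIV p (p t) + of_int m) - (t + of_int m) = of_int j * real n" by simp
  then have "p (inv_into UNIV p (p t) + of_int m) = p (t + of_int m)"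
    using p unfolding line_quotient_def by blast
  ultimately show ?thesis by (simp add: translation_def)
qed

lemma translation_fixes_iff:
  assumes p: "line_quotient n S p"
  shows "translation S p m (p t) = p t \<longleftrightarrow> int n dvd m"
proof -
  have "translation S p m (p t) = p t \<longleftrightarrow> (\<exists>j::int. (t + of_int m) - t = of_int j * real n)"
    unfolding translation_apply[OF p] using p by (simp add: line_quotient_def)
  also have "\<dots> \<longleftrightarrow> (\<exists>j::int. real_of_int m = of_int (int n * j))"
    by (simp add: mult.commute)
  also have "\<dots> \<longleftrightarrow> int n dvd m" unfolding of_int_eq_iff dvd_def ..
  finally show ?thesis .
qed

text \<open>A point may be represented by any of its preimages, so an extensional map is recognised as a
  translation on the line.\<close>

lemma translation_eqI:
  assumes p: "line_quotient n S p" and z: "\<And>t. f (p t) = p (t + of_int m)" and f: "f \<in> extensional (topspace S)"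
  shows "f = translation S p m"
proof (rule extensionalityI[OF f])
  show "translation S p m \<in> extensional (topspace S)" by (simp add: translation_def)
  fix x assume "x \<in> topspace S"
  then have "x \<in> p ` topspace euclideanreal"
    using p quotient_imp_surjective_map[of euclideanreal S p] by (simp add: line_quotient_def)
  then obtain t where "x = p t" by blast
  then show "f x = translation S p m x" using z translation_apply[OF p] by simp
qed

lemma translation_cong:
  assumes p: "line_quotient n S p" and "int n dvd k - m"
  shows "translation S p k = translation S p m"
proof (rule translation_eqI[OF p])
  obtain j where "k - m = int n * j" using assms(2) by (rule dvdE)
  then have "of_int k - of_int m = of_int j * real n"
    by (metis mult.commute of_int_diff of_int_mult of_int_of_nat_eq)
  then have "(t + of_int k) - (t + of_int m) = of_int j * real n" for t by simp
  then show "translation S p k (p t) = p (t + of_int m)" for t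
    using p unfolding translation_apply[OF p] line_quotient_def by blast
qed (simp add: translation_def)

lemma translation_homeomorphic_maps:
  assumes p: "line_quotient n S p"
  shows "homeomorphic_maps S S (translation S p m) (translation S p (- m))"
proof -
  have q: "quotient_map euclideanreal S p" using p by (simp add: line_quotient_def)
  have top: "topspace S = range p" using quotient_imp_surjective_map[OF q] by simp
  have "continuous_map S S (translation S p k)" for k
  proof (rule continuous_compose_quotient_map[OF q])
    have "continuous_map euclideanreal S (p \<circ> (\<lambda>t. t + of_int k))"
      by (rule continuous_map_compose[OF _ quotient_imp_continuous_map[OF q]])
        (auto intro!: continuous_intros)
    moreover have "translation S p k \<circ> p = p \<circ> (\<lambda>t. t + of_int k)"
      using translation_apply[OF p] by auto
    ultimately show "continuous_map euclideanreal S (translation S p k \<circ> p)" by simp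
  qed
  then show ?thesis
    unfolding homeomorphic_maps_def top by (auto simp: translation_apply[OF p])
qed

lemma translation_Bij:
  assumes p: "line_quotient n S p"
  shows "translation S p m \<in> Bij (topspace S)"
proof -
  have "homeomorphic_map S S (translation S p m)"
    using translation_homeomorphic_maps[OF p] homeomorphic_map_maps by blast
  then have "bij_betw (translation S p m) (topspace S) (topspace S)"
    by (simp add: bij_betw_def homeomorphic_imp_injective_map homeomorphic_imp_surjective_map)
  then show ?thesis by (simp add: Bij_def translation_def)
qed

lemma translation_compose:
  assumes p: "line_quotient n S p"
  shows "compose (topspace S) (translation S p k) (translation S p m) = translation S p (k + m)"
proof (rule translation_eqI[OF p])
  have "p t \<in> topspace S" for t
    using p quotient_imp_surjective_map[of euclideanreal S p] by (auto simp: line_quotient_def)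
  then show "compose (topspace S) (translation S p k) (translation S p m) (p t) = p (t + of_int (k + m))" for t
    by (simp add: compose_def translation_apply[OF p] algebra_simps)
qed simp

lemma translation_image_cell:
  assumes p: "line_quotient n S p" and e: "e \<in> open_cells (unit_cells S p)"
  shows "translation S p m ` e \<in> open_cells (unit_cells S p)"
proof -
  consider k :: int where "e = {p (of_int k)}" | k :: int where "e = p ` {of_int k<..<of_int k + 1}"
    using e unfolding open_cells_unit_cells by blast
  then show ?thesis
  proof cases
    case (1 k)
    then have "translation S p m ` e = {p (of_int (k + m))}" by (simp add: translation_apply[OF p])
    then show ?thesis unfolding open_cells_unit_cells by blast
  next
    case (2 k)
    then have "translation S p m ` e = p ` ((\<lambda>t. t + of_int m) ` {of_int k<..<of_int k + 1})"
      by (simp add: image_image translation_apply[OF p])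
    also have "(\<lambda>t. t + of_int m) ` {of_int k<..<of_int k + 1} = {of_int (k + m)<..<real_of_int (k + m) + 1}"
      by (auto simp: image_iff intro!: bexI[of _ "_ - of_int m"])
    finally show ?thesis unfolding open_cells_unit_cells by blast
  qed
qed

lemma translation_bij_cells:
  assumes p: "line_quotient n S p"
  shows "bij_betw (\<lambda>e. translation S p m ` e) (open_cells (unit_cells S p)) (open_cells (unit_cells S p))"
proof (rule bij_betw_byWitness[where f' = "\<lambda>e. translation S p (- m) ` e"])
  have "translation S p (- k) ` translation S p k ` e = e" if e: "e \<in> open_cells (unit_cells S p)" for e k
  proof -
    have "e \<subseteq> range p" using e unfolding open_cells_unit_cells by blast
    then have "translation S p (- k) (translation S p k x) = x" if "x \<in> e" for x
      using that by (auto simp: translation_apply[OF p] dest!: subsetD)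
    then show ?thesis by (force simp: image_image)
  qed
  from this[of _ m] this[of _ "- m"]
  show "\<forall>e\<in>open_cells (unit_cells S p). translation S p (- m) ` translation S p m ` e = e"
    "\<forall>e\<in>open_cells (unit_cells S p). translation S p m ` translation S p (- m) ` e = e" by auto
qed (use translation_image_cell[OF p] in auto)

text \<open>A translation preserving an edge sends its midpoint to a point that differs from the midpoint by an
  integer, modulo \<open>n\<close>; the only such point in the edge is the midpoint. Hence the translation is
  by a multiple of \<open>n\<close> and is the identity.\<close>

lemma translation_fixes_invariant_cell:
  assumes p: "line_quotient n S p" and e: "e \<in> open_cells (unit_cells S p)"
    and inv: "translation S p m ` e = e" and x: "x \<in> e"
  shows "translation S p m x = x"
proof -
  consider k :: int where "e = {p (of_int k)}" | k :: int where "e = p ` {of_int k<..<of_int k + 1}"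
    using e unfolding open_cells_unit_cells by blast
  then show ?thesis
  proof cases
    case 1
    then show ?thesis using inv x by auto
  next
    case (2 k)
    let ?c = "real_of_int k + 1 / 2"
    have "p ?c \<in> e" unfolding 2 by (rule imageI) simp
    then have "translation S p m (p ?c) \<in> e" using inv by blast
    then obtain s where s: "s \<in> {of_int k<..<of_int k + 1}" "p (?c + of_int m) = p s"
      unfolding 2 translation_apply[OF p] by blast
    then obtain j :: int where "?c + of_int m - s = of_int j * real n"
      using p unfolding line_quotient_def by blast
    then have "s = ?c + of_int (m - j * int n)" by simp
    moreover have "i = 0" if "s = ?c + of_int i" for i
    proof -
      have "real_of_int i < of_int 1" "of_int (- 1) < real_of_int i" using s(1) that by auto
      then show ?thesis unfolding of_int_less_iff by linarith
    qed
    ultimately have "m - j * int n = 0" by blast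
    then have "int n dvd m" by simp
    then show ?thesis using x translation_fixes_iff[OF p] unfolding 2 by blast
  qed
qed

section \<open>Cyclic extensions act on a line or circle\<close>

text \<open>Let \<open>a\<close> generate \<open>G\<close> modulo \<open>H\<close> and let \<open>d\<close> be its order there (\<open>0\<close> if infinite). Then \<open>x\<close> acts on
  the quotient of the line by \<open>d\<close> as the translation by any exponent of \<open>x\<close>, which is well defined
  modulo \<open>d\<close>. The quotient group acts freely, so all isotropy groups are equal to \<open>H\<close>.\<close>

lemma (in normal) cyclic_FactGroup_acts:
  assumes "cyclic_group (G Mod H)"
  obtains X \<phi> where "X \<in> P4" "cellular_action G X \<phi>"
    "\<And>x. x \<in> topspace (space X) \<Longrightarrow> stabilizer G \<phi> x = H"
proof -
  obtain a where a: "a \<in> carrier G" "\<And>x. x \<in> carrier G \<Longrightarrow> \<exists>n::int. H #> x = H #> a [^] n"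
    using assms cyclic_FactGroup_iff by blast
  obtain d where "d \<ge> 0" and d': "{m::int. \<exists>s\<in>{\<one>}. H #> s = H #> a [^] m} = {m. d dvd m}"
    by (rule exponents_multiples[OF triv_subgroup a(1)])
  have one: "H #> \<one> = H" using subset by (rule coset_mult_one)
  have d: "H #> a [^] m = H \<longleftrightarrow> d dvd m" for m
  proof -
    have "m \<in> {m::int. \<exists>s\<in>{\<one>}. H #> s = H #> a [^] m} \<longleftrightarrow> m \<in> {m. d dvd m}" by (simp only: d')
    then show ?thesis using one by auto
  qed
  define expo where "expo = (\<lambda>x. SOME m::int. H #> x = H #> a [^] m)"
  have expo: "H #> x = H #> a [^] expo x" if "x \<in> carrier G" for x
    unfolding expo_def by (rule someI_ex) (rule a(2)[OF that])
  have expo_unique: "d dvd k - m" if x: "x \<in> carrier G" "H #> x = H #> a [^] k" "H #> x = H #> a [^] m" for x k m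
    using rcos_diff[OF x(1) x(1) a(1) x(2,3)] x(1) one d[of "k - m"] by simp
  obtain S :: "complex topology" and p where p: "line_quotient (nat d) S p" and haus: "Hausdorff_space S"
    and S: "S homeomorphic_space top_of_set (sphere (0::complex) 1) \<or> S homeomorphic_space (euclidean :: real topology)"
    by (rule line_quotient_exists)
  have nd: "int (nat d) = d" using \<open>d \<ge> 0\<close> by simp
  have top: "topspace S = range p"
    using p quotient_imp_surjective_map[of euclideanreal S p] by (simp add: line_quotient_def)
  let ?X = "unit_cells S p" and ?\<phi> = "\<lambda>x. translation S p (expo x)"
  have space: "space ?X = S" by (simp add: unit_cells_def)
  have "?X \<in> P4" using CW_complex_unit_cells[OF p haus] S by (simp add: P4_def space)
  moreover have "cellular_action G ?X ?\<phi>"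
    unfolding cellular_action_def space
  proof (intro conjI ballI impI)
    have "?\<phi> \<in> hom G (BijGroup (topspace S))"
    proof (rule homI)
      show "?\<phi> x \<in> carrier (BijGroup (topspace S))" for x
        by (simp add: BijGroup_def translation_Bij[OF p])
      fix x y assume xy: "x \<in> carrier G" "y \<in> carrier G"
      have "H #> (x \<otimes> y) = H #> a [^] (expo x + expo y)"
        unfolding int_pow_mult[OF a(1)] rcos_sum[OF xy, symmetric]
          rcos_sum[OF int_pow_closed[OF a(1)] int_pow_closed[OF a(1)], symmetric]
          expo[OF xy(1), symmetric] expo[OF xy(2), symmetric] ..
      then have "d dvd expo (x \<otimes> y) - (expo x + expo y)"
        using expo_unique[of "x \<otimes> y"] expo[of "x \<otimes> y"] xy by simp
      then have "?\<phi> (x \<otimes> y) = translation S p (expo x + expo y)"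
        using translation_cong[OF p, unfolded nd] by blast
      then show "?\<phi> (x \<otimes> y) = ?\<phi> x \<otimes>\<^bsub>BijGroup (topspace S)\<^esub> ?\<phi> y"
        by (simp add: BijGroup_def translation_Bij[OF p] translation_compose[OF p])
    qed
    then show "group_action G (topspace S) ?\<phi>"
      by (intro group_action.intro group_hom.intro group_BijGroup is_group group_hom_axioms.intro)
    show "homeomorphic_map S S (?\<phi> g)" for g
      using translation_homeomorphic_maps[OF p] homeomorphic_map_maps by blast
    show "bij_betw (\<lambda>e. ?\<phi> g ` e) (open_cells ?X) (open_cells ?X)" for g
      by (rule translation_bij_cells[OF p])
    show "?\<phi> g x = x" if "e \<in> open_cells ?X" "?\<phi> g ` e = e" "x \<in> e" for g e x
      by (rule translation_fixes_invariant_cell[OF p that])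
  qed
  moreover have "stabilizer G ?\<phi> x = H" if "x \<in> topspace (space ?X)" for x
  proof -
    have "x \<in> range p" using that by (simp add: space top)
    then obtain t where t: "x = p t" by blast
    have "g \<in> stabilizer G ?\<phi> x \<longleftrightarrow> g \<in> H" if g: "g \<in> carrier G" for g
    proof -
      have "g \<in> stabilizer G ?\<phi> x \<longleftrightarrow> d dvd expo g"
        using g translation_fixes_iff[OF p, unfolded nd] by (simp add: stabilizer_def t)
      also have "\<dots> \<longleftrightarrow> H #> g = H" using d expo[OF g] by simp
      also have "\<dots> \<longleftrightarrow> g \<in> H"
        using coset_join1[OF _ g subgroup_axioms] coset_join2[OF g subgroup_axioms] by blast
      finally show ?thesis .
    qed
    then show ?thesis using subset by (auto simp: stabilizer_def)
  qed
  ultimately show ?thesis using that by blast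
qed

text \<open>Each step of a polycyclic series is one step of the closure process: the extension acts
  on a line or circle with the previous term as its only isotropy group.\<close>

lemma (in group) polycyclic_seq_imp_Ncell:
  "polycyclic_seq G H \<Longrightarrow> Ncell P4 (G\<lparr>carrier := H\<rparr>)"
proof (induction rule: polycyclic_seq.induct)
  case unity
  have "trivial_group (G\<lparr>carrier := {\<one>}\<rparr>)"
    using subgroup_imp_group[OF triv_subgroup] by (simp add: trivial_group_def)
  then show ?case by (rule Ncell.trivial)
next
  case (extension K H)
  interpret N: normal K "G\<lparr>carrier := H\<rparr>" by (rule extension)
  obtain X \<phi> where X: "X \<in> P4" "cellular_action (G\<lparr>carrier := H\<rparr>) X \<phi>"
    "\<And>x. x \<in> topspace (space X) \<Longrightarrow> stabilizer (G\<lparr>carrier := H\<rparr>) \<phi> x = K"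
    by (rule N.cyclic_FactGroup_acts) (use extension in auto)
  show ?case
    by (rule Ncell.action[OF N.is_group X(1,2)]) (use X(3) extension.IH in simp)
qed

section \<open>The class generated by lines and circles\<close>

theorem proposition3p6:
  shows "{G :: ('a, 'b) monoid_scheme. Ncell P4 G} = {G. polycyclic_group G}"
proof (intro equalityI subsetI CollectI; elim CollectE)
  show "polycyclic_group G" if "Ncell P4 G" for G :: "('a, 'b) monoid_scheme"
    using that by (rule Ncell_P4_imp_polycyclic)
  show "Ncell P4 G" if "polycyclic_group G" for G :: "('a, 'b) monoid_scheme"
  proof -
    have "Ncell P4 (G\<lparr>carrier := carrier G\<rparr>)"
      using that group.polycyclic_seq_imp_Ncell[of G "carrier G"] unfolding polycyclic_group_def by blast
    then show ?thesis by simp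
  qed
qed

end
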